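(* Let $H_1,H_2$ be real Hilbert spaces (possibly infinite dimensional), let $g:H_1\to\mathbb{R}\cup\{\infty\}$ and $f:H_2\to\mathbb{R}\cup\{\infty\}$ be proper, convex and lower semicontinuous, let $L:H_1\to H_2$ be a bounded linear operator, and let $\lambda>0$. Assume that both the primal problem $(P)$ and the dual problem $(D)$ have optimal solutions and that at least one of the regularity conditions (R1), (R2) of the context holds. Suppose that $$\partial\bigl(g^*\circ(-L^* )\bigr)(b)=-L\,\partial g^*(-L^*b)\qquad\text{for all } b\in H_2,$$ and that the alternating split Bregman algorithm (with initial elements $b^0,d^0\in H_2$) is well defined. Let $\{u^k\}$, $\{d^k\}$, $\{b^k\}$ be the three sequences generated by the algorithm. Then $\{d^k\}$ and $\{b^k\}$ converge weakly in $H_2$ to some $\hat d$ and $\hat b$, respectively. Moreover, $\lambda\hat b$ is a solution of the dual problem $(D)$, the sequence $\{d^k-Lu^{k+1}\}$ converges strongly to zero, and $$\sum_{k=0}^{\infty}\|d^k-Lu^{k+1}\|^2<\infty .$$ Furthermore, $L^{-1}(\hat d)=\{u\in H_1: Lu=\hat d\}$ contains a solution $\hat u$ of the primal problem $(P)$. In particular, if $L$ is injective, then $\{u^k\}$ has at most one weak cluster point, and any such weak cluster point $\bar u$ satisfies $\bar u=\hat u$.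
   Context: Hilbert spaces are identified with their duals; $L^*:H_2\to H_1$ is the adjoint of $L$; $f^*,g^*$ denote the convex (Fenchel) conjugates; $\partial$ is the convex subdifferential; $\mathrm{dom}$ denotes the effective domain. Primal problem $(P)$: $\min_{u\in H_1}\{g(u)+f(Lu)\}$. Dual problem $(D)$: $-\min_{b\in H_2}\{g^*(-L^*b)+f^*(b)\}$; a solution of $(D)$ is a minimizer over $b\in H_2$ of $g^*(-L^*b)+f^*(b)$. Regularity conditions: (R1) there exists $x\in\mathrm{dom}(g)\cap\mathrm{dom}(f\circ L)$ such that $f$ is continuous at $Lx$; (R2) $0\in\mathrm{int}\,(L\,\mathrm{dom}(g)-\mathrm{dom}(f))$. Alternating split Bregman algorithm: given $b^0,d^0\in H_2$, for $k\ge1$: (1) let $u^k$ be a minimizer over $H_1$ of $I_1^k(u)=g(u)+\frac{\lambda}{2}\|b^{k-1}+Lu-d^{k-1}\|^2$; (2) let $d^k$ be the minimizer over $H_2$ of $I_2^k(d)=f(d)+\frac{\lambda}{2}\|b^{k-1}+Lu^k-d\|^2$; (3) set $b^k=b^{k-1}+Lu^k-d^k$. The algorithm is said to be well defined if for all $k\ge1$ the functionals $I_1^k$ and $I_2^k$ have minimizers in $H_1$ and $H_2$, respectively. *)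

theory Defs
  imports "HOL-Analysis.Analysis"
begin

text \<open>A real Hilbert space is a type of class \<open>{real_inner, complete_space}\<close>; it is
  identified with its dual through the inner product.  The adjoint of a bounded linear operator
  is the library's \<open>adjoint\<close>, a choice that is well determined here by the Riesz representation
  theorem.\<close>

subsection \<open>Extended-valued convex functions\<close>

definition effdom :: "('a \<Rightarrow> ereal) \<Rightarrow> 'a set" where
  "effdom f = {x. f x < \<infinity>}"

text \<open>Functions with values in \<open>\<real> \<union> {\<infinity>}\<close> have values in \<open>ereal\<close> here;
  properness excludes the value \<open>-\<infinity>\<close>.\<close>

definition proper :: "('a \<Rightarrow> ereal) \<Rightarrow> bool" where
  "proper f \<longleftrightarrow> (\<forall>x. f x \<noteq> -\<infinity>) \<and> effdom f \<noteq> {}"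

definition convex_ereal :: "('a::real_vector \<Rightarrow> ereal) \<Rightarrow> bool" where
  "convex_ereal f \<longleftrightarrow>
     (\<forall>x y. \<forall>t\<in>{0<..<1}. f ((1 - t) *\<^sub>R x + t *\<^sub>R y) \<le> ereal (1 - t) * f x + ereal t * f y)"

definition lsc :: "('a::topological_space \<Rightarrow> ereal) \<Rightarrow> bool" where
  "lsc f \<longleftrightarrow> (\<forall>x. f x \<le> Liminf (nhds x) f)"

definition conjugate :: "('a::real_inner \<Rightarrow> ereal) \<Rightarrow> 'a \<Rightarrow> ereal" where
  "conjugate f p = (SUP x. ereal (p \<bullet> x) - f x)"

text \<open>With the usual convention, the subdifferential is empty at points where the function is
  not finite.\<close>

definition subdifferential :: "('a::real_inner \<Rightarrow> ereal) \<Rightarrow> 'a \<Rightarrow> 'a set" where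
  "subdifferential f x =
     {p. \<bar>f x\<bar> \<noteq> \<infinity> \<and> (\<forall>y. f x + ereal (p \<bullet> (y - x)) \<le> f y)}"

abbreviation minimizer :: "('a \<Rightarrow> ereal) \<Rightarrow> 'a \<Rightarrow> bool" where
  "minimizer F x \<equiv> is_arg_min F (\<lambda>_. True) x"

subsection \<open>Weak topology\<close>

definition weak_topology :: "'a::real_inner topology" where
  "weak_topology = pullback_topology UNIV (\<lambda>x h. x \<bullet> h) euclidean"

definition weakly_converges :: "(nat \<Rightarrow> 'a::real_inner) \<Rightarrow> 'a \<Rightarrow> bool" where
  "weakly_converges s x \<longleftrightarrow> limitin weak_topology s x sequentially"

text \<open>Cluster points are topological: every weak neighbourhood contains infinitely many members
  of the sequence.  All weak limits of subsequences are included.\<close>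

definition weak_cluster_point :: "(nat \<Rightarrow> 'a::real_inner) \<Rightarrow> 'a \<Rightarrow> bool" where
  "weak_cluster_point s x \<longleftrightarrow>
     (\<forall>U. openin weak_topology U \<and> x \<in> U \<longrightarrow> (\<exists>\<^sub>F k in sequentially. s k \<in> U))"

lemma weakly_converges_iff: "weakly_converges s x \<longleftrightarrow> (\<forall>h. (\<lambda>k. s k \<bullet> h) \<longlonglongrightarrow> x \<bullet> h)"
proof -
  have op: "openin weak_topology U \<longleftrightarrow> (\<exists>V. open V \<and> U = (\<lambda>x h. x \<bullet> h) -` V)" for U :: "'a set"
    by (simp add: weak_topology_def openin_pullback_topology)
  have "weakly_converges s x \<longleftrightarrow>
      (\<forall>V. open V \<and> (\<lambda>h. x \<bullet> h) \<in> V \<longrightarrow> (\<forall>\<^sub>F k in sequentially. (\<lambda>h. s k \<bullet> h) \<in> V))"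
    unfolding weakly_converges_def limitin_def op
    by (auto simp: weak_topology_def topspace_pullback_topology)
  also have "\<dots> \<longleftrightarrow> limitin (product_topology (\<lambda>_. euclidean) UNIV)
      (\<lambda>k h. s k \<bullet> h) (\<lambda>h. x \<bullet> h) sequentially"
    by (simp add: limitin_def euclidean_product_topology)
  also have "\<dots> \<longleftrightarrow> (\<forall>h. (\<lambda>k. s k \<bullet> h) \<longlonglongrightarrow> x \<bullet> h)"
    by (simp add: limitin_componentwise)
  finally show ?thesis .
qed

lemma weak_cluster_point_subseq:
  assumes "strict_mono r" "weakly_converges (s \<circ> r) x"
  shows "weak_cluster_point s x"
  unfolding weak_cluster_point_def
proof (intro allI impI)
  fix U assume "openin weak_topology U \<and> x \<in> U"
  then have "\<forall>\<^sub>F k in sequentially. s (r k) \<in> U"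
    using assms(2) by (auto simp: weakly_converges_def limitin_def)
  then obtain N where N: "\<And>k. k \<ge> N \<Longrightarrow> s (r k) \<in> U"
    by (auto simp: eventually_sequentially)
  show "\<exists>\<^sub>F k in sequentially. s k \<in> U"
    unfolding frequently_sequentially
  proof
    fix m
    have "r (max m N) \<ge> m"
      using seq_suble[OF assms(1), of "max m N"] by simp
    then show "\<exists>n\<ge>m. s n \<in> U"
      using N[of "max m N"] by auto
  qed
qed

subsection \<open>Primal and dual problem, regularity conditions\<close>

definition primal_objective ::
  "('a \<Rightarrow> ereal) \<Rightarrow> ('b \<Rightarrow> ereal) \<Rightarrow> ('a \<Rightarrow> 'b) \<Rightarrow> 'a \<Rightarrow> ereal" where
  "primal_objective g f L u = g u + f (L u)"

definition dual_objective ::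
  "('a::real_inner \<Rightarrow> ereal) \<Rightarrow> ('b::real_inner \<Rightarrow> ereal) \<Rightarrow> ('a \<Rightarrow> 'b) \<Rightarrow> 'b \<Rightarrow> ereal" where
  "dual_objective g f L b = conjugate g (- adjoint L b) + conjugate f b"

definition primal_solution ::
  "('a \<Rightarrow> ereal) \<Rightarrow> ('b \<Rightarrow> ereal) \<Rightarrow> ('a \<Rightarrow> 'b) \<Rightarrow> 'a \<Rightarrow> bool" where
  "primal_solution g f L u \<longleftrightarrow> minimizer (primal_objective g f L) u"

definition dual_solution ::
  "('a::real_inner \<Rightarrow> ereal) \<Rightarrow> ('b::real_inner \<Rightarrow> ereal) \<Rightarrow> ('a \<Rightarrow> 'b) \<Rightarrow> 'b \<Rightarrow> bool" where
  "dual_solution g f L b \<longleftrightarrow> minimizer (dual_objective g f L) b"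

definition regularity1 ::
  "('a \<Rightarrow> ereal) \<Rightarrow> ('b::t2_space \<Rightarrow> ereal) \<Rightarrow> ('a \<Rightarrow> 'b) \<Rightarrow> bool" where
  "regularity1 g f L \<longleftrightarrow> (\<exists>x \<in> effdom g \<inter> effdom (f \<circ> L). isCont f (L x))"

definition regularity2 ::
  "('a \<Rightarrow> ereal) \<Rightarrow> ('b::real_normed_vector \<Rightarrow> ereal) \<Rightarrow> ('a \<Rightarrow> 'b) \<Rightarrow> bool" where
  "regularity2 g f L \<longleftrightarrow> 0 \<in> interior {L x - y | x y. x \<in> effdom g \<and> y \<in> effdom f}"

subsection \<open>Alternating split Bregman algorithm\<close>

text \<open>The two functionals of a step, in terms of the preceding iterates.\<close>

definition I1 ::
  "('a \<Rightarrow> ereal) \<Rightarrow> ('a \<Rightarrow> 'b::real_normed_vector) \<Rightarrow> real \<Rightarrow> 'b \<Rightarrow> 'b \<Rightarrow> 'a \<Rightarrow> ereal" where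
  "I1 g L lam b d u = g u + ereal (lam / 2 * (norm (b + L u - d))\<^sup>2)"

definition I2 ::
  "('b \<Rightarrow> ereal) \<Rightarrow> ('a \<Rightarrow> 'b::real_normed_vector) \<Rightarrow> real \<Rightarrow> 'b \<Rightarrow> 'a \<Rightarrow> 'b \<Rightarrow> ereal" where
  "I2 f L lam b u d = f d + ereal (lam / 2 * (norm (b + L u - d))\<^sup>2)"

text \<open>The initial elements are \<open>b 0\<close> and \<open>d 0\<close>; the value \<open>u 0\<close> is not part of the algorithm and
  stays unconstrained.\<close>

definition split_bregman ::
  "('a \<Rightarrow> ereal) \<Rightarrow> ('b::real_normed_vector \<Rightarrow> ereal) \<Rightarrow> ('a \<Rightarrow> 'b) \<Rightarrow> real \<Rightarrow>
   (nat \<Rightarrow> 'a) \<Rightarrow> (nat \<Rightarrow> 'b) \<Rightarrow> (nat \<Rightarrow> 'b) \<Rightarrow> bool" where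
  "split_bregman g f L lam u d b \<longleftrightarrow>
     (\<forall>k\<ge>1. minimizer (I1 g L lam (b (k - 1)) (d (k - 1))) (u k) \<and>
            minimizer (I2 f L lam (b (k - 1)) (u k)) (d k) \<and>
            b k = b (k - 1) + L (u k) - d k)"

definition split_bregman_well_defined ::
  "('a \<Rightarrow> ereal) \<Rightarrow> ('b::real_normed_vector \<Rightarrow> ereal) \<Rightarrow> ('a \<Rightarrow> 'b) \<Rightarrow> real \<Rightarrow>
   (nat \<Rightarrow> 'a) \<Rightarrow> (nat \<Rightarrow> 'b) \<Rightarrow> (nat \<Rightarrow> 'b) \<Rightarrow> bool" where
  "split_bregman_well_defined g f L lam u d b \<longleftrightarrow>
     (\<forall>k\<ge>1. (\<exists>v. minimizer (I1 g L lam (b (k - 1)) (d (k - 1))) v) \<and>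
            (\<exists>e. minimizer (I2 f L lam (b (k - 1)) (u k)) e))"

end

theory Submission
  imports Defs
begin

text \<open>Write \<open>p\<^sub>k = lam *\<^sub>R (b k + L (u (Suc k)) - d k)\<close>.  The optimality conditions of the two
minimizations of a step are
\<open>- adjoint L p\<^sub>k \<in> subdifferential g (u (Suc k))\<close> and
\<open>lam *\<^sub>R b (Suc k) \<in> subdifferential f (d (Suc k))\<close>.  They turn the algorithm into a
Douglas-Rachford iteration for the dual problem whose governing sequence is \<open>b k + d k\<close>.

Suppose that \<open>(x, lam *\<^sub>R p)\<close> is a saddle point, that is, a pair satisfying the
Karush-Kuhn-Tucker inclusions \<open>kkt_point\<close>.  Monotonicity of the subdifferentials of \<open>g\<close> and
\<open>f\<close> yields \<open>fejer_descent\<close>: from the first step on, the distance of \<open>b k + d k\<close> to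
\<open>p + L x\<close> decreases, and its square drops by at least the square of the residual \<open>d k - L (u (Suc k))\<close>.  Hence the squared
residuals are summable, \<open>b\<close> and \<open>d\<close> are bounded, and their increments tend to zero.  A saddle
point exists by Fenchel duality (\<open>kkt_point_exists\<close>): each regularity condition makes the
perturbation function \<open>y \<mapsto> inf\<^sub>u (g u + f (L u + y))\<close> bounded above near \<open>0\<close>, for the second
condition by a Baire argument, and a convex function that is bounded above near a point where
it is finite has a subgradient there.

For the weak limits, add the two subgradient inequalities of a step in conjugate form.  The
terms that are quadratic in the iterates combine into products of a bounded and a null
sequence, so the inequality survives weak limits (\<open>weak_cluster_inequality\<close>).  It says that a
weak cluster point \<open>(bb, dd)\<close> of the pairs \<open>(b k, d k)\<close> solves the dual problem in the form
\<open>- dd \<in> \<partial>(g\<^sup>* \<circ> (- L\<^sup>*)) (lam *\<^sub>R bb)\<close> and \<open>dd \<in> \<partial>f\<^sup>* (lam *\<^sub>R bb)\<close>.  The chain rule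
assumed in the theorem writes \<open>dd = L x\<close> with
\<open>x \<in> \<partial>g\<^sup>* (- L\<^sup>* (lam *\<^sub>R bb))\<close>, and \<open>subdifferential_conjugate_inverse\<close> makes
\<open>(x, lam *\<^sub>R bb)\<close> a saddle point.  So every cluster point is one to which the distances
converge; Opial's argument together with monotonicity of the subdifferential of \<open>f\<close> shows that
there is only one (\<open>weak_cluster_unique\<close>), and by weak compactness the sequences converge.\<close>

section \<open>Closed convex sets in Hilbert space\<close>

text \<open>A substitute for weak compactness of bounded closed convex sets.  The minimal squared norms \<open>q n\<close>
of the sets increase to a limit, and by the parallelogram identity almost-minimal points form a
Cauchy sequence, since midpoints stay in the larger of two sets.\<close>

lemma nested_convex_Inter_nonempty:
  fixes C :: "nat \<Rightarrow> 'a::{real_inner, complete_space} set"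
  assumes closed: "\<And>n. closed (C n)" and convex: "\<And>n. convex (C n)"
    and ne: "\<And>n. C n \<noteq> {}" and dec: "decseq C" and bdd: "bounded (C 0)"
  shows "\<exists>x. \<forall>n. x \<in> C n"
proof -
  obtain B where B: "\<And>x. x \<in> C 0 \<Longrightarrow> norm x \<le> B"
    using bdd by (auto simp: bounded_iff)
  have sub: "C n \<subseteq> C m" if "m \<le> n" for m n
    using dec that by (auto simp: decseq_def)
  define q where "q n = (INF x\<in>C n. (norm x)\<^sup>2)" for n
  have bb: "bdd_below ((\<lambda>x. (norm x)\<^sup>2) ` A)" for A :: "'a set"
    by (rule bdd_belowI[of _ 0]) auto
  have q_le: "q n \<le> (norm x)\<^sup>2" if "x \<in> C n" for n x
    unfolding q_def by (rule cINF_lower[OF bb that])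
  have "\<exists>x\<in>C n. (norm x)\<^sup>2 < q n + 1 / real (Suc n)" for n
  proof -
    have "Inf ((\<lambda>x. (norm x)\<^sup>2) ` C n) < q n + 1 / real (Suc n)"
      by (simp add: q_def)
    then show ?thesis
      using cInf_less_iff[OF _ bb, of "C n"] ne[of n] by auto
  qed
  then obtain x where xC: "\<And>n. x n \<in> C n"
    and x_lt: "\<And>n. (norm (x n))\<^sup>2 < q n + 1 / real (Suc n)"
    by metis
  have inc: "incseq q"
    unfolding incseq_def q_def
    using sub by (intro allI impI cINF_superset_mono bb ne) auto
  have "q n \<le> B\<^sup>2" for n
  proof -
    have "norm (x n) \<le> B" using B xC sub[of 0 n] by blast
    then show ?thesis using q_le[OF xC[of n]]
      by (meson norm_ge_zero order_trans power_mono)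
  qed
  then obtain Q where Q: "q \<longlonglongrightarrow> Q" and q_Q: "\<And>n. q n \<le> Q"
    using incseq_convergent[OF inc] by metis
  have "(\<lambda>n. 2 * (Q - q n) + 4 * (1 / real (Suc n))) \<longlonglongrightarrow> 2 * (Q - Q) + 4 * 0"
    by (intro tendsto_intros Q LIMSEQ_Suc[OF lim_1_over_n])
  then have small: "(\<lambda>n. 2 * (Q - q n) + 4 * (1 / real (Suc n))) \<longlonglongrightarrow> 0"
    by simp
  have key: "(norm (x n - x k))\<^sup>2 < 2 * (Q - q n) + 4 * (1 / real (Suc n))" if "n \<le> k" for n k
  proof -
    have "x k \<in> C n" using xC sub[OF that] by blast
    then have "(1/2) *\<^sub>R x n + (1/2) *\<^sub>R x k \<in> C n"
      using convex[of n] xC[of n] by (auto intro!: convexD)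
    then have "q n \<le> (norm ((1/2) *\<^sub>R x n + (1/2) *\<^sub>R x k))\<^sup>2"
      by (rule q_le)
    moreover have "(norm (x n - x k))\<^sup>2
        = 2 * (norm (x n))\<^sup>2 + 2 * (norm (x k))\<^sup>2 - 4 * (norm ((1/2) *\<^sub>R x n + (1/2) *\<^sub>R x k))\<^sup>2"
      by (simp add: power2_norm_eq_inner algebra_simps inner_commute)
    moreover have "1 / real (Suc k) \<le> 1 / real (Suc n)"
      using that by (simp add: field_simps)
    moreover note x_lt[of n] x_lt[of k] q_Q[of k]
    ultimately show ?thesis
      unfolding times_divide_eq_right by argo
  qed
  have "Cauchy x"
    unfolding Cauchy_altdef
  proof (intro allI impI)
    fix e :: real assume "e > 0"
    then have "\<forall>\<^sub>F n in sequentially. 2 * (Q - q n) + 4 * (1 / real (Suc n)) < e\<^sup>2"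
      using order_tendstoD(2)[OF small, of "e\<^sup>2"] by simp
    then obtain N where N: "\<And>n. n \<ge> N \<Longrightarrow> 2 * (Q - q n) + 4 * (1 / real (Suc n)) < e\<^sup>2"
      by (auto simp: eventually_sequentially)
    show "\<exists>M. \<forall>m\<ge>M. \<forall>n>m. dist (x m) (x n) < e"
    proof (intro exI allI impI)
      fix m n assume "m \<ge> N" "n > m"
      then have "(norm (x m - x n))\<^sup>2 < e\<^sup>2"
        using key[of m n] N[of m] by linarith
      then show "dist (x m) (x n) < e"
        using \<open>e > 0\<close> by (simp add: dist_norm power_less_imp_less_base)
    qed
  qed
  then obtain l where l: "x \<longlonglongrightarrow> l"
    by (auto simp: Cauchy_convergent_iff convergent_def)
  have "l \<in> C n" for n
  proof (rule Lim_in_closed_set[OF closed _ _ l])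
    show "\<forall>\<^sub>F k in sequentially. x k \<in> C n"
      unfolding eventually_sequentially using xC sub by (intro exI[of _ n]) blast
  qed auto
  then show ?thesis by blast
qed

lemma nonpos_if_le_small_multiples:
  fixes x y :: real
  assumes "\<And>t. 0 < t \<Longrightarrow> t < 1 \<Longrightarrow> x \<le> t * y"
  shows "x \<le> 0"
proof -
  have "((\<lambda>t. t * y) \<longlongrightarrow> 0 * y) (at_right 0)"
    by (intro tendsto_intros)
  moreover have "\<forall>\<^sub>F t in at_right (0::real). x \<le> t * y"
    unfolding eventually_at_right_field using assms by (intro exI[of _ 1]) simp
  ultimately show ?thesis
    by (intro tendsto_lowerbound[where F = "at_right 0"]) auto
qed

lemma norm_add_scaleR_square:
  fixes x y :: "'a::real_inner"
  shows "(norm (x + t *\<^sub>R y))\<^sup>2 = (norm x)\<^sup>2 + 2 * t * (x \<bullet> y) + t\<^sup>2 * (norm y)\<^sup>2"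
  unfolding power2_norm_eq_inner
  by (simp add: inner_add_left inner_add_right inner_commute power2_eq_square algebra_simps)

text \<open>For \<open>S\<close> the epigraph of \<open>f\<close>, the point \<open>z\<close> is the value of the proximal map of \<open>f\<close> at \<open>a\<close>, so that
\<open>a - z\<close> is a subgradient of \<open>f\<close> at \<open>z\<close>; for \<open>S = C \<times> {0}\<close> it is the projection of \<open>a\<close> onto \<open>C\<close>.
The affine minorant makes the strongly convex function \<open>Q\<close> coercive on \<open>S\<close>, so its sublevel sets are
bounded and nested, and a common point of them minimizes \<open>Q\<close>.\<close>

lemma supported_convex_set_resolvent:
  fixes S :: "('a::{real_inner, complete_space} \<times> real) set"
  assumes S: "closed S" "convex S" "S \<noteq> {}"
    and minorant: "\<And>x r. (x, r) \<in> S \<Longrightarrow> p \<bullet> x - c \<le> r"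
  shows "\<exists>z r. (z, r) \<in> S \<and> (\<forall>y s. (y, s) \<in> S \<longrightarrow> r + (a - z) \<bullet> (y - z) \<le> s)"
proof -
  define Q where "Q v = snd v + (norm (fst v - a))\<^sup>2 / 2" for v :: "'a \<times> real"
  define k where "k = p \<bullet> a - c - (norm p)\<^sup>2 / 2"
  \<comment> \<open>Completing the square with the minorant recentres the quadratic at \<open>a - p\<close>.\<close>
  have Q_ge: "(norm (fst v - (a - p)))\<^sup>2 / 2 + k \<le> Q v" if "v \<in> S" for v
  proof -
    have "(norm (fst v - (a - p)))\<^sup>2 / 2 + k = p \<bullet> fst v - c + (norm (fst v - a))\<^sup>2 / 2"
      unfolding k_def power2_norm_eq_inner by (simp add: field_simps inner_simps inner_commute)
    then show ?thesis using minorant[of "fst v" "snd v"] that by (simp add: Q_def)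
  qed
  have bb: "bdd_below (Q ` S)"
  proof (rule bdd_belowI2)
    show "k \<le> Q v" if "v \<in> S" for v
      using Q_ge[OF that] zero_le_power2[of "norm (fst v - (a - p))"] by linarith
  qed
  define m where "m = Inf (Q ` S)"
  define C where "C n = {v \<in> S. Q v \<le> m + 1 / real (Suc n)}" for n
  \<comment> \<open>The defect in this convexity inequality is \<open>s * t / 2\<close> times a square.\<close>
  have Q_comb: "Q (s *\<^sub>R v + t *\<^sub>R w) \<le> s * Q v + t * Q w"
    if "s \<ge> 0" "t \<ge> 0" "s + t = 1" for s t v w
  proof -
    have s: "s = 1 - t" using that by simp
    have "s * Q v + t * Q w - Q (s *\<^sub>R v + t *\<^sub>R w) = s * t / 2 * (norm (fst v - fst w))\<^sup>2"
      unfolding s Q_def power2_norm_eq_inner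
      by (simp add: field_simps inner_commute)
        (simp add: algebra_simps inner_commute power2_eq_square)
    moreover have "s * t / 2 * (norm (fst v - fst w))\<^sup>2 \<ge> 0"
      using that by simp
    ultimately show ?thesis by linarith
  qed
  have "\<exists>v. \<forall>n. v \<in> C n"
  proof (rule nested_convex_Inter_nonempty)
    fix n
    have "continuous_on S Q" unfolding Q_def by (intro continuous_intros) auto
    then have "closed (S \<inter> Q -` {..m + 1 / real (Suc n)})"
      using S(1) by (intro continuous_closed_preimage) auto
    then show "closed (C n)"
      by (simp add: C_def vimage_def Int_def)
    show "convex (C n)"
    proof (rule convexI)
      fix v w and s t :: real
      assume vw: "v \<in> C n" "w \<in> C n" and st: "0 \<le> s" "0 \<le> t" "s + t = 1"
      have "Q (s *\<^sub>R v + t *\<^sub>R w) \<le> s * Q v + t * Q w" using Q_comb[OF st] .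
      also have "\<dots> \<le> s * (m + 1 / real (Suc n)) + t * (m + 1 / real (Suc n))"
        using vw st by (intro add_mono mult_left_mono) (auto simp: C_def)
      also have "\<dots> = m + 1 / real (Suc n)"
        using st(3) by (metis distrib_right mult_1)
      finally show "s *\<^sub>R v + t *\<^sub>R w \<in> C n"
        using vw st convexD[OF S(2)] by (auto simp: C_def)
    qed
    have "Inf (Q ` S) < m + 1 / real (Suc n)" by (simp add: m_def)
    then show "C n \<noteq> {}"
      using cInf_less_iff[OF _ bb] S(3) by (fastforce simp: C_def)
  next
    show "decseq C"
    proof (rule decseq_SucI)
      fix n
      have "1 / real (Suc (Suc n)) \<le> 1 / real (Suc n)" by (simp add: field_simps)
      then show "C (Suc n) \<subseteq> C n" by (auto simp: C_def simp del: of_nat_Suc)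
    qed
  next
    define R where "R = sqrt (2 * (m + 1 - k))"
    have "C 0 \<subseteq> cball (a - p) R \<times> {- (norm p * (norm (a - p) + R)) - c .. m + 1}"
    proof
      fix v assume "v \<in> C 0"
      then have v: "v \<in> S" "Q v \<le> m + 1" by (auto simp: C_def)
      have "(norm (fst v - (a - p)))\<^sup>2 \<le> 2 * (m + 1 - k)"
        using Q_ge[OF v(1)] v(2) by simp
      then have R: "norm (fst v - (a - p)) \<le> R"
        unfolding R_def using real_le_rsqrt by blast
      have "norm (fst v) \<le> norm (a - p) + norm (fst v - (a - p))"
        by (metis add.commute diff_add_cancel norm_triangle_ineq)
      then have "norm (fst v) \<le> norm (a - p) + R" using R by linarith
      then have "norm p * norm (fst v) \<le> norm p * (norm (a - p) + R)"
        by (intro mult_left_mono) auto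
      moreover have "- (norm p * norm (fst v)) \<le> p \<bullet> fst v"
        using Cauchy_Schwarz_ineq2[of p "fst v"] by linarith
      moreover have "p \<bullet> fst v - c \<le> snd v" using minorant[of "fst v" "snd v"] v(1) by simp
      ultimately have "- (norm p * (norm (a - p) + R)) - c \<le> snd v" by linarith
      moreover have "snd v \<le> m + 1"
        using v(2) zero_le_power2[of "norm (fst v - a)"] unfolding Q_def by linarith
      ultimately show "v \<in> cball (a - p) R \<times> {- (norm p * (norm (a - p) + R)) - c .. m + 1}"
        using R by (cases v) (auto simp: dist_norm norm_minus_commute)
    qed
    then show "bounded (C 0)"
      by (rule bounded_subset[rotated]) (intro bounded_Times bounded_cball bounded_closed_interval)
  qed
  then obtain v where v: "\<And>n. v \<in> C n" by blast
  then have vS: "v \<in> S" by (auto simp: C_def)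
  have "(\<lambda>n. m + 1 / real (Suc n)) \<longlonglongrightarrow> m + 0"
    by (intro tendsto_intros LIMSEQ_Suc[OF lim_1_over_n])
  then have "Q v \<le> m + 0"
    by (rule Lim_bounded2[where N = 0]) (use v in \<open>auto simp: C_def\<close>)
  then have v_min: "Q v \<le> Q w" if "w \<in> S" for w
    using cINF_lower[OF bb that] by (simp add: m_def)
  obtain z r where zr: "v = (z, r)" by (cases v)
  have "r + (a - z) \<bullet> (y - z) \<le> s" if ys: "(y, s) \<in> S" for y s
  proof -
    have line: "r + (a - z) \<bullet> (y - z) - s \<le> t * ((norm (y - z))\<^sup>2 / 2)" if t: "0 < t" "t < 1" for t
    proof -
      have "(1 - t) *\<^sub>R v + t *\<^sub>R (y, s) \<in> S"
        using S(2) vS ys t by (intro convexD) auto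
      from v_min[OF this] have "0 \<le> Q ((1 - t) *\<^sub>R v + t *\<^sub>R (y, s)) - Q v" by simp
      also have "\<dots> = t * (s - r - (a - z) \<bullet> (y - z) + t * ((norm (y - z))\<^sup>2 / 2))"
        proof -
        have "fst ((1 - t) *\<^sub>R v + t *\<^sub>R (y, s)) - a = (z - a) + t *\<^sub>R (y - z)"
          unfolding zr by (simp add: algebra_simps)
        then have "(norm (fst ((1 - t) *\<^sub>R v + t *\<^sub>R (y, s)) - a))\<^sup>2
            = (norm (z - a))\<^sup>2 + 2 * t * ((z - a) \<bullet> (y - z)) + t\<^sup>2 * (norm (y - z))\<^sup>2"
          by (simp only: norm_add_scaleR_square)
        also have "(z - a) \<bullet> (y - z) = - ((a - z) \<bullet> (y - z))"
          by (simp add: inner_diff_left)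
        finally have w: "(norm (fst ((1 - t) *\<^sub>R v + t *\<^sub>R (y, s)) - a))\<^sup>2
            = (norm (z - a))\<^sup>2 + 2 * t * (- ((a - z) \<bullet> (y - z))) + t\<^sup>2 * (norm (y - z))\<^sup>2" .
        have alg: "(1 - t) * r + t * s + (N + 2 * t * (- A) + t\<^sup>2 * D) / 2 - (r + N / 2)
            = t * (s - r - A + t * (D / 2))" for A D N :: real
          by (simp add: field_simps power2_eq_square)
        have "snd ((1 - t) *\<^sub>R v + t *\<^sub>R (y, s)) = (1 - t) * r + t * s" "fst v = z" "snd v = r"
          by (simp_all add: zr)
        then show ?thesis
          unfolding Q_def w by (simp only: alg)
      qed
      finally show ?thesis using t by (simp add: zero_le_mult_iff)
    qed
    then have "r + (a - z) \<bullet> (y - z) - s \<le> 0" by (rule nonpos_if_le_small_multiples)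
    then show ?thesis by simp
  qed
  then show ?thesis using vS zr by blast
qed

lemma closed_convex_projection:
  fixes C :: "'a::{real_inner, complete_space} set"
  assumes "closed C" "convex C" "C \<noteq> {}"
  shows "\<exists>z\<in>C. \<forall>y\<in>C. (a - z) \<bullet> (y - z) \<le> 0"
proof -
  have "\<exists>z r. (z, r) \<in> C \<times> {0::real} \<and>
      (\<forall>y s. (y, s) \<in> C \<times> {0::real} \<longrightarrow> r + (a - z) \<bullet> (y - z) \<le> s)"
    by (rule supported_convex_set_resolvent[where p = 0 and c = 0])
      (use assms in \<open>auto intro: closed_Times convex_Times\<close>)
  then show ?thesis by auto
qed

section \<open>Riesz representation and weak compactness\<close>

text \<open>The representing vector is a multiple of the point of least norm in the hyperplane \<open>\<phi> x = 1\<close>.\<close>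

lemma riesz_representation:
  fixes \<phi> :: "'a::{real_inner, complete_space} \<Rightarrow> real"
  assumes "bounded_linear \<phi>"
  shows "\<exists>w. \<forall>x. \<phi> x = w \<bullet> x"
proof (cases "\<forall>x. \<phi> x = 0")
  case True
  then show ?thesis by (intro exI[of _ 0]) simp
next
  case False
  interpret bounded_linear \<phi> by fact
  obtain e where e: "\<phi> e \<noteq> 0" using False by blast
  let ?C = "\<phi> -` {1}"
  have "closed ?C"
    by (intro closed_vimage) (auto intro: linear_continuous_on assms)
  moreover have "convex ?C"
    by (auto intro!: convexI simp: add scale)
  moreover have "e /\<^sub>R \<phi> e \<in> ?C" using e by (simp add: scale)
  ultimately obtain a where a: "\<phi> a = 1" and vi: "\<And>y. \<phi> y = 1 \<Longrightarrow> (0 - a) \<bullet> (y - a) \<le> 0"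
    using closed_convex_projection[of ?C 0] by blast
  have orth: "a \<bullet> h = 0" if "\<phi> h = 0" for h
    using vi[of "a + h"] vi[of "a - h"] a that by (simp add: add diff)
  have "a \<noteq> 0" using a zero by force
  have "\<phi> x = (a /\<^sub>R (a \<bullet> a)) \<bullet> x" for x
  proof -
    have "a \<bullet> (x - \<phi> x *\<^sub>R a) = 0"
      by (rule orth) (simp add: diff scale a)
    then show ?thesis using \<open>a \<noteq> 0\<close> by (simp add: inner_diff_right field_simps)
  qed
  then show ?thesis by blast
qed

text \<open>\<open>adjoint\<close> is a choice among the operators satisfying the defining identity; Riesz representation
shows that there is one.\<close>

lemma adjoint_inner:
  fixes L :: "'a::{real_inner, complete_space} \<Rightarrow> 'b::real_inner"
  assumes "bounded_linear L"
  shows "adjoint L p \<bullet> x = p \<bullet> L x"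
proof -
  have "\<exists>w. \<forall>x. L x \<bullet> p = x \<bullet> w" for p
    using riesz_representation[of "\<lambda>x. L x \<bullet> p"]
      bounded_linear_compose[OF bounded_linear_inner_left assms]
    by (metis inner_commute)
  then have "\<exists>L'. \<forall>x y. L x \<bullet> y = x \<bullet> L' y" by metis
  then have "\<forall>x y. L x \<bullet> y = x \<bullet> adjoint L y"
    unfolding adjoint_def by (rule someI_ex)
  then show ?thesis by (simp add: inner_commute)
qed

text \<open>Weak compactness of balls, stated with a finer filter in place of a subnet.  The functionals
\<open>\<lambda>h. s i \<bullet> h\<close> lie in a product of compact intervals, so Tychonoff gives a pointwise cluster
functional \<open>\<phi>\<close>; it is linear and bounded, hence represented by a vector.\<close>

lemma bounded_weak_cluster_filter:
  fixes s :: "'i \<Rightarrow> 'a::{real_inner, complete_space}"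
  assumes F: "F \<noteq> bot" and bdd: "\<And>i. norm (s i) \<le> B"
  shows "\<exists>G w. G \<le> F \<and> G \<noteq> bot \<and> (\<forall>h. ((\<lambda>i. s i \<bullet> h) \<longlongrightarrow> w \<bullet> h) G)"
proof -
  let ?K = "PiE UNIV (\<lambda>h::'a. {- (B * norm h) .. B * norm h})"
  let ?\<phi> = "\<lambda>i h. s i \<bullet> h"
  have "compactin (product_topology (\<lambda>_. euclidean) UNIV) ?K"
    by (simp add: compactin_PiE)
  then have K: "compact ?K" by (simp add: euclidean_product_topology)
  have mem: "?\<phi> i \<in> ?K" for i
  proof -
    have "\<bar>s i \<bullet> h\<bar> \<le> B * norm h" for h
      using Cauchy_Schwarz_ineq2[of "s i" h] mult_right_mono[OF bdd[of i] norm_ge_zero[of h]]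
      by linarith
    then have "- (B * norm h) \<le> s i \<bullet> h \<and> s i \<bullet> h \<le> B * norm h" for h
      by (smt (verit))
    then show ?thesis by (auto simp: PiE_iff)
  qed
  have "filtermap ?\<phi> F \<noteq> bot" using F by (simp add: filtermap_bot_iff)
  moreover have "eventually (\<lambda>x. x \<in> ?K) (filtermap ?\<phi> F)"
    using mem by (simp add: eventually_filtermap)
  ultimately obtain \<phi> where \<phi>: "\<phi> \<in> ?K" "inf (nhds \<phi>) (filtermap ?\<phi> F) \<noteq> bot"
    using K unfolding compact_filter by blast
  define G where "G = inf (filtercomap ?\<phi> (nhds \<phi>)) F"
  have "G \<noteq> bot"
  proof
    assume "G = bot"
    then obtain P Q where PQ: "eventually P (nhds \<phi>)" "eventually Q F"
      "\<And>i. P (?\<phi> i) \<Longrightarrow> Q i \<Longrightarrow> False"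
      unfolding G_def trivial_limit_def eventually_inf eventually_filtercomap by metis
    have "eventually (\<lambda>x. \<exists>i. x = ?\<phi> i \<and> Q i) (filtermap ?\<phi> F)"
      unfolding eventually_filtermap using PQ(2) by (auto elim: eventually_mono)
    then have "eventually (\<lambda>x. False) (inf (nhds \<phi>) (filtermap ?\<phi> F))"
      unfolding eventually_inf using PQ(1,3) by blast
    then show False using \<phi>(2) by (simp add: trivial_limit_def)
  qed
  have "filterlim ?\<phi> (nhds \<phi>) G"
    unfolding G_def by (rule filterlim_mono[OF filterlim_filtercomap order_refl]) simp
  moreover have "(\<lambda>f. f h) \<midarrow>\<phi>\<rightarrow> \<phi> h" for h
  proof -
    have "continuous_on UNIV (\<lambda>f::'a \<Rightarrow> real. f h)"
      by (rule continuous_on_product_coordinates)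
    then show ?thesis by (simp add: continuous_on_def)
  qed
  ultimately have lim: "((\<lambda>i. s i \<bullet> h) \<longlongrightarrow> \<phi> h) G" for h
    using tendsto_compose by blast
  have "bounded_linear \<phi>"
  proof (rule bounded_linear_intro)
    fix x y and c :: real
    show "\<phi> (x + y) = \<phi> x + \<phi> y"
      using tendsto_unique[OF \<open>G \<noteq> bot\<close> lim[of "x + y"]] tendsto_add[OF lim[of x] lim[of y]]
      by (simp add: inner_add_right)
    show "\<phi> (c *\<^sub>R x) = c *\<^sub>R \<phi> x"
      using tendsto_unique[OF \<open>G \<noteq> bot\<close> lim[of "c *\<^sub>R x"]] tendsto_mult_left[OF lim[of x], of c]
      by simp
    show "norm (\<phi> x) \<le> norm x * B"
      using \<phi>(1) by (auto simp: PiE_iff abs_le_iff mult.commute minus_le_iff)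
  qed
  then obtain w where w: "\<And>x. \<phi> x = w \<bullet> x" using riesz_representation by blast
  have "((\<lambda>i. s i \<bullet> h) \<longlongrightarrow> w \<bullet> h) G" for h
    using lim[of h] by (simp add: w)
  moreover have "G \<le> F" by (simp add: G_def)
  ultimately show ?thesis using \<open>G \<noteq> bot\<close> by blast
qed

text \<open>If convergence failed against some \<open>h\<close>, the indices at which it fails would carry a filter along
which a weak cluster point different from \<open>z\<close> exists.\<close>

lemma weakly_converges_unique_cluster:
  fixes s :: "nat \<Rightarrow> 'a::{real_inner, complete_space}"
  assumes bdd: "\<And>n. norm (s n) \<le> B"
    and unique: "\<And>G w. G \<le> sequentially \<Longrightarrow> G \<noteq> bot \<Longrightarrow>
        (\<And>h. ((\<lambda>n. s n \<bullet> h) \<longlongrightarrow> w \<bullet> h) G) \<Longrightarrow> w = z"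
  shows "weakly_converges s z"
  unfolding weakly_converges_iff
proof (intro allI tendstoI, rule ccontr)
  fix h and e :: real
  assume "e > 0" and not_ev: "\<not> (\<forall>\<^sub>F n in sequentially. dist (s n \<bullet> h) (z \<bullet> h) < e)"
  define F where "F = inf sequentially (principal {n. \<not> dist (s n \<bullet> h) (z \<bullet> h) < e})"
  have "F \<noteq> bot"
    using not_ev unfolding F_def trivial_limit_def eventually_inf_principal by simp
  then obtain G w where G: "G \<le> F" "G \<noteq> bot" and w: "\<And>h. ((\<lambda>n. s n \<bullet> h) \<longlongrightarrow> w \<bullet> h) G"
    using bounded_weak_cluster_filter[where s = s and B = B] bdd by blast
  have "w = z"
    by (rule unique[OF _ G(2) w]) (use G(1) in \<open>auto simp: F_def\<close>)
  then have "\<forall>\<^sub>F n in G. dist (s n \<bullet> h) (z \<bullet> h) < e"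
    using tendstoD[OF w \<open>e > 0\<close>] by simp
  moreover have "\<forall>\<^sub>F n in F. \<not> dist (s n \<bullet> h) (z \<bullet> h) < e"
    unfolding F_def eventually_inf_principal by simp
  then have "\<forall>\<^sub>F n in G. \<not> dist (s n \<bullet> h) (z \<bullet> h) < e"
    using filter_leD[OF G(1)] by blast
  ultimately have "\<forall>\<^sub>F n in G. False" by eventually_elim simp
  then show False using G(2) by (simp add: trivial_limit_def)
qed

text \<open>The set of vectors whose inner product with \<open>h\<close> is close to \<open>x \<bullet> h\<close> is a weak neighbourhood of
\<open>x\<close>.\<close>

lemma weak_cluster_point_inner_limit:
  assumes cl: "weak_cluster_point s x" and lim: "(\<lambda>k. s k \<bullet> h) \<longlonglongrightarrow> l"
  shows "x \<bullet> h = l"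
proof (rule ccontr)
  assume "x \<bullet> h \<noteq> l"
  define e where "e = \<bar>x \<bullet> h - l\<bar> / 2"
  have "e > 0" using \<open>x \<bullet> h \<noteq> l\<close> by (simp add: e_def)
  have "open {\<phi> :: 'a \<Rightarrow> real. \<bar>\<phi> h - x \<bullet> h\<bar> < e}"
  proof -
    have "continuous_on UNIV (\<lambda>\<phi> :: 'a \<Rightarrow> real. \<phi> h)"
      by (rule continuous_on_product_coordinates)
    then show ?thesis by (intro open_Collect_less continuous_intros)
  qed
  then have "openin weak_topology {v. \<bar>v \<bullet> h - x \<bullet> h\<bar> < e}"
    unfolding weak_topology_def openin_pullback_topology by force
  then have "\<exists>\<^sub>F k in sequentially. \<bar>s k \<bullet> h - x \<bullet> h\<bar> < e"
    using cl \<open>e > 0\<close> unfolding weak_cluster_point_def by force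
  moreover have "\<forall>\<^sub>F k in sequentially. \<bar>s k \<bullet> h - l\<bar> < e"
    using tendstoD[OF lim \<open>e > 0\<close>] by (simp add: dist_real_def)
  then have "\<forall>\<^sub>F k in sequentially. \<bar>s k \<bullet> h - x \<bullet> h\<bar> < e \<longrightarrow>
      \<bar>s k \<bullet> h - x \<bullet> h\<bar> < e \<and> \<bar>s k \<bullet> h - l\<bar> < e"
    by (rule eventually_mono) simp
  ultimately have "\<exists>\<^sub>F k in sequentially. \<bar>s k \<bullet> h - x \<bullet> h\<bar> < e \<and> \<bar>s k \<bullet> h - l\<bar> < e"
    by (rule frequently_rev_mp)
  then obtain k where "\<bar>s k \<bullet> h - x \<bullet> h\<bar> < e" "\<bar>s k \<bullet> h - l\<bar> < e"
    using frequently_ex by blast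
  then have "\<bar>x \<bullet> h - l\<bar> < e + e" by linarith
  then show False by (simp add: e_def)
qed

section \<open>Epigraphs, conjugates and subgradients\<close>

text \<open>Only real heights occur, so that epigraphs are convex sets of an inner product space and the
arithmetic of extended reals can be left aside.\<close>

definition epi :: "('a \<Rightarrow> ereal) \<Rightarrow> ('a \<times> real) set" where
  "epi f = {(x, r). f x \<le> ereal r}"

lemma mem_epi: "(x, r) \<in> epi f \<longleftrightarrow> f x \<le> ereal r"
  by (simp add: epi_def)

lemma convex_epi:
  assumes "convex_ereal f"
  shows "convex (epi f)"
proof (rule convexI)
  fix v w and a t :: real
  assume vw: "v \<in> epi f" "w \<in> epi f" and at: "0 \<le> a" "0 \<le> t" "a + t = 1"
  obtain x r y s where v: "v = (x, r)" and w: "w = (y, s)" by (cases v, cases w)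
  have a: "a = 1 - t" using at by simp
  consider "t = 0" | "t = 1" | "0 < t" "t < 1" using at by fastforce
  then show "a *\<^sub>R v + t *\<^sub>R w \<in> epi f"
  proof cases
    case 3
    have "f ((1 - t) *\<^sub>R x + t *\<^sub>R y) \<le> ereal (1 - t) * f x + ereal t * f y"
      using assms 3 by (simp add: convex_ereal_def)
    also have "\<dots> \<le> ereal (1 - t) * ereal r + ereal t * ereal s"
      using vw 3 by (intro add_mono ereal_mult_left_mono) (auto simp: v w mem_epi)
    finally show ?thesis by (simp add: a v w mem_epi)
  qed (use vw a in auto)
qed

lemma closed_epi:
  fixes f :: "'a::metric_space \<Rightarrow> ereal"
  assumes "lsc f"
  shows "closed (epi f)"
  unfolding closed_sequential_limits
proof (intro allI impI, elim conjE)
  fix v l assume v: "\<forall>n. v n \<in> epi f" and lim: "v \<longlonglongrightarrow> l"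
  obtain x r where l: "l = (x, r)" by (cases l)
  have x: "(\<lambda>n. fst (v n)) \<longlonglongrightarrow> x" and r: "(\<lambda>n. snd (v n)) \<longlonglongrightarrow> r"
    using tendsto_fst[OF lim] tendsto_snd[OF lim] by (simp_all add: l)
  have "f x \<le> ereal r"
  proof (rule ccontr)
    assume "\<not> f x \<le> ereal r"
    then have "ereal r < f x" by simp
    from ereal_dense2[OF this] obtain c where c: "ereal r < ereal c" "ereal c < f x" by blast
    have "f x \<le> Liminf (nhds x) f" using assms by (simp add: lsc_def)
    then have "\<forall>\<^sub>F z in nhds x. ereal c < f z"
      using c(2) unfolding le_Liminf_iff by blast
    then have "\<forall>\<^sub>F n in sequentially. ereal c < f (fst (v n))"
      using x unfolding filterlim_iff by blast
    moreover have "\<forall>\<^sub>F n in sequentially. snd (v n) < c"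
      using r c(1) by (intro order_tendstoD(2)) auto
    ultimately have "\<forall>\<^sub>F n in sequentially. False"
    proof eventually_elim
      case (elim n)
      have "f (fst (v n)) \<le> ereal (snd (v n))"
        using v by (metis mem_epi prod.collapse)
      also have "\<dots> < ereal c" using elim by simp
      finally show False using elim by simp
    qed
    then show False by simp
  qed
  then show "l \<in> epi f" by (simp add: l mem_epi)
qed

lemma proper_finite_point:
  assumes "proper f"
  obtains x r where "f x = ereal r"
proof -
  obtain x where "f x < \<infinity>" "f x \<noteq> -\<infinity>"
    using assms by (auto simp: proper_def effdom_def)
  then show ?thesis using that by (cases "f x") auto
qed

lemma proper_finite_below:
  assumes "proper f" "f x < \<infinity>"
  obtains r where "f x = ereal r"
  using assms by (cases "f x") (auto simp: proper_def)

lemma subdifferential_iff_epi: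
  "p \<in> subdifferential f x \<longleftrightarrow>
     (\<exists>r. f x = ereal r \<and> (\<forall>y s. (y, s) \<in> epi f \<longrightarrow> r + p \<bullet> (y - x) \<le> s))"
  (is "_ \<longleftrightarrow> ?R")
proof
  assume p: "p \<in> subdifferential f x"
  then obtain r where r: "f x = ereal r" by (cases "f x") (auto simp: subdifferential_def)
  have "r + p \<bullet> (y - x) \<le> s" if "(y, s) \<in> epi f" for y s
  proof -
    have "ereal (r + p \<bullet> (y - x)) \<le> f y"
      using p r by (simp add: subdifferential_def)
    also have "\<dots> \<le> ereal s" using that by (simp add: mem_epi)
    finally show ?thesis by simp
  qed
  with r show ?R by blast
next
  assume ?R
  then obtain r where r: "f x = ereal r"
    and le: "\<And>y s. f y \<le> ereal s \<Longrightarrow> r + p \<bullet> (y - x) \<le> s"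
    by (auto simp: mem_epi)
  have "f x + ereal (p \<bullet> (y - x)) \<le> f y" for y
  proof (cases "f y")
    case (real s)
    then show ?thesis using le[of y s] r by simp
  next
    case MInf
    then show ?thesis using le[of y "r + p \<bullet> (y - x) - 1"] by simp
  qed simp
  then show "p \<in> subdifferential f x" by (simp add: subdifferential_def r)
qed

lemma subdifferential_monotone:
  assumes "p \<in> subdifferential f x" "q \<in> subdifferential f y"
  shows "0 \<le> (p - q) \<bullet> (x - y)"
proof -
  obtain r s where r: "f x = ereal r" and s: "f y = ereal s"
    and le: "r + p \<bullet> (y - x) \<le> s" "s + q \<bullet> (x - y) \<le> r"
    using assms unfolding subdifferential_iff_epi mem_epi by (metis order_refl)
  then show ?thesis by (simp add: inner_diff_left inner_diff_right)
qed

lemma conjugate_le_iff_epi: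
  "conjugate f p \<le> ereal c \<longleftrightarrow> (\<forall>x s. (x, s) \<in> epi f \<longrightarrow> p \<bullet> x - s \<le> c)"
proof -
  have "ereal (p \<bullet> x) - f x \<le> ereal c \<longleftrightarrow> (\<forall>s. (x, s) \<in> epi f \<longrightarrow> p \<bullet> x - s \<le> c)" for x
  proof (cases "f x")
    case (real r)
    then show ?thesis by (auto simp: mem_epi)
  next
    case MInf
    then show ?thesis by (auto simp: mem_epi intro!: exI[of _ "p \<bullet> x - c - 1"])
  qed (simp add: mem_epi)
  then show ?thesis by (auto simp: conjugate_def SUP_le_iff)
qed

lemma conjugate_ge_epi:
  assumes "(x, s) \<in> epi f"
  shows "ereal (p \<bullet> x - s) \<le> conjugate f p"
proof (cases "conjugate f p")
  case (real c)
  then show ?thesis using assms conjugate_le_iff_epi[of f p c] by simp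
next
  case MInf
  then have "conjugate f p \<le> ereal (p \<bullet> x - s - 1)" by simp
  then show ?thesis using assms unfolding conjugate_le_iff_epi by fastforce
qed simp

lemma conjugate_finite:
  assumes "proper f" "conjugate f p \<le> ereal c"
  obtains r where "conjugate f p = ereal r"
proof -
  obtain x s where "f x = ereal s" using proper_finite_point[OF assms(1)] .
  then have "ereal (p \<bullet> x - s) \<le> conjugate f p" by (intro conjugate_ge_epi) (simp add: mem_epi)
  then show ?thesis using that assms(2) by (cases "conjugate f p") auto
qed

lemma conjugate_neq_MInf:
  assumes "proper f"
  shows "conjugate f p \<noteq> -\<infinity>"
proof
  assume "conjugate f p = -\<infinity>"
  moreover from this obtain r where "conjugate f p = ereal r"
    using conjugate_finite[OF assms, of p 0] by auto
  ultimately show False by simp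
qed

lemma subdifferential_conjugate_le:
  assumes "p \<in> subdifferential f x"
  obtains c where "conjugate f p \<le> ereal c"
proof -
  obtain r where "\<And>y s. (y, s) \<in> epi f \<Longrightarrow> r + p \<bullet> (y - x) \<le> s"
    using assms unfolding subdifferential_iff_epi by blast
  then have "conjugate f p \<le> ereal (p \<bullet> x - r)"
    unfolding conjugate_le_iff_epi by (force simp: inner_diff_right)
  then show ?thesis by (rule that)
qed

text \<open>Minty's argument in place of the biconjugate theorem.  Finiteness of \<open>conjugate f p\<close> supplies an
affine minorant of \<open>f\<close>, so the proximal point \<open>z\<close> of \<open>x + p\<close> exists, and \<open>q = x + p - z\<close> is a
subgradient of \<open>f\<close> at \<open>z\<close>.  Then \<open>z\<close> is a subgradient of the conjugate at \<open>q\<close>, and monotonicity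
gives \<open>(x - z) \<bullet> (p - q) \<ge> 0\<close>; but \<open>p - q = - (x - z)\<close>, hence \<open>z = x\<close> and \<open>q = p\<close>.\<close>

lemma subdifferential_conjugate_inverse:
  fixes f :: "'a::{real_inner, complete_space} \<Rightarrow> ereal"
  assumes f: "proper f" "convex_ereal f" "lsc f"
    and x: "x \<in> subdifferential (conjugate f) p"
  shows "p \<in> subdifferential f x"
proof -
  obtain c where c: "conjugate f p = ereal c"
    and x_sub: "\<And>q s. conjugate f q \<le> ereal s \<Longrightarrow> c + x \<bullet> (q - p) \<le> s"
    using x unfolding subdifferential_iff_epi mem_epi by blast
  have c_ge: "p \<bullet> y - s \<le> c" if "(y, s) \<in> epi f" for y s
    using conjugate_ge_epi[OF that, of p] c by simp
  have "epi f \<noteq> {}"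
    using proper_finite_point[OF f(1)] by (metis mem_epi order_refl empty_iff)
  moreover have "p \<bullet> y - c \<le> s" if "(y, s) \<in> epi f" for y s
    using c_ge[OF that] by simp
  ultimately obtain z r where z: "(z, r) \<in> epi f"
    and z_sub: "\<And>y s. (y, s) \<in> epi f \<Longrightarrow> r + (x + p - z) \<bullet> (y - z) \<le> s"
    using supported_convex_set_resolvent[of "epi f" p c "x + p"]
      closed_epi[OF f(3)] convex_epi[OF f(2)] by blast
  define q where "q = x + p - z"
  have "conjugate f q \<le> ereal (q \<bullet> z - r)"
    unfolding conjugate_le_iff_epi using z_sub by (force simp: q_def inner_diff_right)
  then have "c + x \<bullet> (q - p) \<le> q \<bullet> z - r" by (rule x_sub)
  moreover have "(x - z) \<bullet> (x - z) = x \<bullet> (q - p) + p \<bullet> z - q \<bullet> z"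
    by (simp add: q_def inner_diff_left inner_diff_right inner_add_left inner_add_right inner_commute)
  ultimately have "(x - z) \<bullet> (x - z) \<le> 0" using c_ge[OF z] by simp
  then have "x = z"
    by (metis eq_iff_diff_eq_0 inner_eq_zero_iff inner_ge_zero order_antisym)
  then have sub: "r + p \<bullet> (y - x) \<le> s" if "(y, s) \<in> epi f" for y s
    using z_sub[OF that] by simp
  have "f x \<le> ereal r" using z \<open>x = z\<close> by (simp add: mem_epi)
  then obtain r' where r': "f x = ereal r'"
    using f(1) by (cases "f x") (auto simp: proper_def)
  then have "r = r'" using sub[of x r'] \<open>f x \<le> ereal r\<close> by (simp add: mem_epi)
  then show ?thesis using r' sub unfolding subdifferential_iff_epi by blast
qed

text \<open>Fermat's rule: compare \<open>x\<close> with points \<open>(1 - t) *\<^sub>R x + t *\<^sub>R y\<close>, divide by \<open>t\<close> and let \<open>t\<close> tend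
to zero, which removes the quadratic remainder.\<close>

lemma minimizer_plus_square_subgradient:
  fixes h :: "'a::real_vector \<Rightarrow> ereal" and M :: "'a \<Rightarrow> 'b::real_inner"
  assumes h: "proper h" "convex_ereal h" and M: "linear M"
    and min: "minimizer (\<lambda>x. h x + ereal (lam / 2 * (norm (c + M x))\<^sup>2)) x"
  obtains r where "h x = ereal r"
    and "\<And>y s. (y, s) \<in> epi h \<Longrightarrow> r - lam * ((c + M x) \<bullet> M (y - x)) \<le> s"
proof -
  let ?q = "\<lambda>x. lam / 2 * (norm (c + M x))\<^sup>2"
  have min: "h x + ereal (?q x) \<le> h y + ereal (?q y)" for y
    using min by (auto simp: is_arg_min_def not_less)
  obtain y0 r0 where "h y0 = ereal r0" using proper_finite_point[OF h(1)] .
  then have "h x < \<infinity>" using min[of y0] by auto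
  then obtain r where r: "h x = ereal r" using proper_finite_below[OF h(1)] by blast
  have "r - lam * ((c + M x) \<bullet> M (y - x)) \<le> s" if ys: "(y, s) \<in> epi h" for y s
  proof -
    have "r - lam * ((c + M x) \<bullet> M (y - x)) - s \<le> t * (lam / 2 * (norm (M (y - x)))\<^sup>2)"
      if t: "0 < t" "t < 1" for t
    proof -
      have alg: "0 \<le> t * (t * D - (r - lam * B - s))"
        if "r + Q \<le> (1 - t) * r + t * s + Q'" "Q' = Q + t * lam * B + t * (t * D)"
        for B D Q Q' :: real
        using that by (simp add: algebra_simps)
      let ?w = "(1 - t) *\<^sub>R x + t *\<^sub>R y"
      have "(1 - t) *\<^sub>R (x, r) + t *\<^sub>R (y, s) \<in> epi h"
        using convex_epi[OF h(2)] ys t r by (intro convexD) (auto simp: mem_epi)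
      then have "h ?w \<le> ereal ((1 - t) * r + t * s)" by (simp add: mem_epi)
      then have "h ?w + ereal (?q ?w) \<le> ereal ((1 - t) * r + t * s + ?q ?w)"
        using add_right_mono[of "h ?w" _ "ereal (?q ?w)"] by fastforce
      then have "r + ?q x \<le> (1 - t) * r + t * s + ?q ?w"
        using order_trans[OF min[of ?w]] r by fastforce
      moreover have "c + M ?w = (c + M x) + t *\<^sub>R M (y - x)"
        using M by (simp add: linear_add linear_diff linear_scale algebra_simps)
      then have "?q ?w = ?q x + t * lam * ((c + M x) \<bullet> M (y - x))
          + t * (t * (lam / 2 * (norm (M (y - x)))\<^sup>2))"
        by (simp only: norm_add_scaleR_square) (simp add: algebra_simps power2_eq_square)
      ultimately have "0 \<le> t * (t * (lam / 2 * (norm (M (y - x)))\<^sup>2)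
          - (r - lam * ((c + M x) \<bullet> M (y - x)) - s))"
        by (rule alg)
      then show ?thesis using t by (simp add: zero_le_mult_iff)
    qed
    from nonpos_if_le_small_multiples[OF this] show ?thesis by simp
  qed
  then show ?thesis using that r by blast
qed

section \<open>Existence of a saddle point\<close>

text \<open>The two inclusions say that \<open>(x, p)\<close> is a saddle point of the Lagrangian.\<close>

definition kkt_point ::
  "('a::real_inner \<Rightarrow> ereal) \<Rightarrow> ('b::real_inner \<Rightarrow> ereal) \<Rightarrow> ('a \<Rightarrow> 'b) \<Rightarrow> 'a \<Rightarrow> 'b \<Rightarrow> bool" where
  "kkt_point g f L x p \<longleftrightarrow>
     - adjoint L p \<in> subdifferential g x \<and> p \<in> subdifferential f (L x)"

text \<open>Here \<open>E\<close> plays the role of the epigraph of a convex function \<open>v\<close> with \<open>v 0 \<ge> 0\<close>, and \<open>p\<close> is a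
linear minorant of \<open>v\<close>.  The bound near \<open>0\<close> makes \<open>v\<close> bounded below by a multiple of \<open>- norm y\<close>, so
\<open>(0, - e)\<close> lies outside the closure of \<open>E\<close> for \<open>e > 0\<close>, and the normal at its projection yields a
\<open>p\<close> with \<open>p \<bullet> y \<le> v y + e\<close>.  The sets \<open>P e\<close> of all such \<open>p\<close> are closed, convex, bounded and
decrease with \<open>e\<close>, so they have a common point.\<close>

lemma supporting_functional_at_zero:
  fixes E :: "('b::{real_inner, complete_space} \<times> real) set"
  assumes E: "convex E"
    and up: "\<And>y r s. (y, r) \<in> E \<Longrightarrow> r \<le> s \<Longrightarrow> (y, s) \<in> E"
    and zero: "\<And>r. (0, r) \<in> E \<Longrightarrow> 0 \<le> r"
    and dlt: "0 < dlt" and bound: "\<And>y. norm y \<le> dlt \<Longrightarrow> (y, M) \<in> E"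
  shows "\<exists>p. \<forall>y r. (y, r) \<in> E \<longrightarrow> p \<bullet> y \<le> r"
proof -
  have "M \<ge> 0" using zero bound[of 0] dlt by simp
  \<comment> \<open>The segment from \<open>(y, r)\<close> to \<open>(y', M)\<close> crosses the axis over \<open>0\<close>, where heights are nonnegative.\<close>
  have lower: "- M * norm y \<le> dlt * r" if yr: "(y, r) \<in> E" for y r
  proof (cases "y = 0")
    case True
    then show ?thesis using zero yr dlt by auto
  next
    case False
    define y' where "y' = - (dlt / norm y) *\<^sub>R y"
    define a where "a = dlt / (norm y + dlt)"
    define b where "b = norm y / (norm y + dlt)"
    have pos: "norm y + dlt > 0" using dlt by (simp add: add_nonneg_pos)
    have ab: "a \<ge> 0" "b \<ge> 0" "a + b = 1"
      using pos dlt by (auto simp: a_def b_def add_divide_distrib[symmetric] add.commute)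
    have "(y', M) \<in> E" using bound[of y'] False dlt by (simp add: y'_def)
    then have "a *\<^sub>R (y, r) + b *\<^sub>R (y', M) \<in> E"
      using yr ab by (intro convexD[OF E])
    moreover have "a *\<^sub>R y + b *\<^sub>R y' = 0"
      using pos False by (simp add: a_def b_def y'_def)
    ultimately have "0 \<le> a * r + b * M" using zero by simp
    also have "a * r + b * M = (dlt * r + norm y * M) / (norm y + dlt)"
      by (simp add: a_def b_def add_divide_distrib)
    finally show ?thesis using pos by (simp add: zero_le_divide_iff mult.commute)
  qed
  have lower': "- M * norm y \<le> dlt * r" if "(y, r) \<in> closure E" for y r
  proof -
    have "closed {v :: 'b \<times> real. - M * norm (fst v) \<le> dlt * snd v}"
      by (intro closed_Collect_le continuous_intros)
    then have "closure E \<subseteq> {v. - M * norm (fst v) \<le> dlt * snd v}"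
      using lower by (intro closure_minimal) auto
    then show ?thesis using that by auto
  qed
  define P where "P e = {p. \<forall>y r. (y, r) \<in> E \<longrightarrow> p \<bullet> y \<le> r + e}" for e :: real
  have P_ne: "P e \<noteq> {}" if e: "e > 0" for e
  proof -
    have "closure E \<noteq> {}" using bound[of 0] dlt by auto
    then obtain z where z: "z \<in> closure E"
      and vi: "\<And>v. v \<in> closure E \<Longrightarrow> ((0, - e) - z) \<bullet> (v - z) \<le> 0"
      using closed_convex_projection[of "closure E" "(0, - e)"] E by (auto intro: convex_closure)
    obtain y0 s0 where z_eq: "z = (y0, s0)" by (cases z)
    define \<alpha> where "\<alpha> = s0 + e"
    have vi': "(norm y0)\<^sup>2 - y0 \<bullet> y \<le> \<alpha> * (r - s0)" if "(y, r) \<in> E" for y r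
    proof -
      have "(y, r) \<in> closure E" using that closure_subset by blast
      from vi[OF this] show ?thesis
        by (simp add: z_eq \<alpha>_def inner_diff_right power2_norm_eq_inner algebra_simps)
    qed
    \<comment> \<open>If \<open>\<alpha> \<le> 0\<close>, high points of \<open>E\<close> over \<open>0\<close> force \<open>y0 = 0\<close>, and \<open>z\<close> contradicts \<open>lower'\<close>.\<close>
    have "\<alpha> > 0"
    proof (rule ccontr)
      assume "\<not> \<alpha> > 0"
      have "(0, M + \<bar>s0\<bar>) \<in> E" using up[of 0 M "M + \<bar>s0\<bar>"] bound[of 0] dlt by simp
      then have "(norm y0)\<^sup>2 \<le> \<alpha> * (M + \<bar>s0\<bar> - s0)" using vi' by fastforce
      also have "\<dots> \<le> 0"
        using \<open>\<not> \<alpha> > 0\<close> \<open>M \<ge> 0\<close> by (intro mult_nonpos_nonneg) auto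
      finally have "y0 = 0" by simp
      then have "0 \<le> dlt * s0" using lower'[of y0 s0] z z_eq by simp
      then have "0 \<le> s0" using dlt by (simp add: zero_le_mult_iff)
      then show False using \<open>\<not> \<alpha> > 0\<close> e by (simp add: \<alpha>_def)
    qed
    define p where "p = - (1 / \<alpha>) *\<^sub>R y0"
    have "p \<bullet> y \<le> r + e" if "(y, r) \<in> E" for y r
    proof -
      have "- (y0 \<bullet> y) \<le> \<alpha> * (r - s0)"
        using vi'[OF that] zero_le_power2[of "norm y0"] by linarith
      then have "- (y0 \<bullet> y) / \<alpha> \<le> r - s0"
        using \<open>\<alpha> > 0\<close> by (simp only: pos_divide_le_eq mult.commute)
      then have "p \<bullet> y \<le> r - s0" by (simp add: p_def)
      then show ?thesis using \<open>\<alpha> > 0\<close> by (simp add: \<alpha>_def)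
    qed
    then show ?thesis by (auto simp: P_def)
  qed
  have "\<exists>p. \<forall>n. p \<in> P (1 / real (Suc n))"
  proof (rule nested_convex_Inter_nonempty)
    fix n
    let ?e = "1 / real (Suc n)"
    have P_eq: "P ?e = (\<Inter>v\<in>E. {p. fst v \<bullet> p \<le> snd v + ?e})"
      by (force simp: P_def inner_commute)
    show "closed (P ?e)" unfolding P_eq by (intro closed_INT ballI closed_halfspace_le)
    show "convex (P ?e)" unfolding P_eq by (intro convex_INT convex_halfspace_le)
    show "P ?e \<noteq> {}" by (rule P_ne) simp
  next
    show "decseq (\<lambda>n. P (1 / real (Suc n)))"
    proof (rule decseq_SucI, rule subsetI)
      fix n p assume p: "p \<in> P (1 / real (Suc (Suc n)))"
      have "1 / real (Suc (Suc n)) \<le> 1 / real (Suc n)" by (simp add: field_simps)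
      then show "p \<in> P (1 / real (Suc n))"
        using p unfolding P_def by (auto simp del: of_nat_Suc) (smt (verit))
    qed
  next
    have "norm p \<le> (M + 1) / dlt" if p: "p \<in> P 1" for p
    proof (cases "p = 0")
      case False
      have "((dlt / norm p) *\<^sub>R p, M) \<in> E" using dlt False by (intro bound) simp
      then have "p \<bullet> ((dlt / norm p) *\<^sub>R p) \<le> M + 1" using p unfolding P_def by blast
      moreover have "p \<bullet> ((dlt / norm p) *\<^sub>R p) = dlt * norm p"
        using False by (simp add: power2_norm_eq_inner[symmetric] power2_eq_square)
      ultimately show ?thesis using dlt by (simp add: pos_le_divide_eq mult.commute)
    qed (use dlt \<open>M \<ge> 0\<close> in simp)
    then show "bounded (P (1 / real (Suc 0)))" by (auto simp: bounded_iff)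
  qed
  then obtain p where p: "\<And>n. p \<in> P (1 / real (Suc n))" by blast
  have "p \<bullet> y \<le> r" if yr: "(y, r) \<in> E" for y r
  proof -
    have "(\<lambda>n. r + 1 / real (Suc n)) \<longlonglongrightarrow> r + 0"
      by (intro tendsto_intros LIMSEQ_Suc[OF lim_1_over_n])
    then have "p \<bullet> y \<le> r + 0"
      by (rule Lim_bounded2[where N = 0]) (use p yr in \<open>auto simp: P_def simp del: of_nat_Suc\<close>)
    then show ?thesis by simp
  qed
  then show ?thesis by blast
qed

lemma convex_difference_image:
  assumes "linear L" "convex A" "convex B"
  shows "convex {w - L u | u w. u \<in> A \<and> w \<in> B}"
proof -
  have "linear (\<lambda>v. snd v - L (fst v))"
    using assms(1) by (intro linearI) (auto simp: linear_add linear_scale algebra_simps)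
  moreover have "{w - L u | u w. u \<in> A \<and> w \<in> B} = (\<lambda>v. snd v - L (fst v)) ` (A \<times> B)"
    by force
  ultimately show ?thesis
    using convex_linear_image convex_Times[OF assms(2,3)] by metis
qed

text \<open>A linear image of a bounded closed convex set is closed: the points of \<open>A \<times> B\<close> mapped within
\<open>1 / Suc n\<close> of a limit point \<open>y\<close> form nested sets to which \<open>nested_convex_Inter_nonempty\<close> applies.\<close>

lemma closed_difference_image:
  fixes L :: "'a::{real_inner, complete_space} \<Rightarrow> 'b::{real_inner, complete_space}"
  assumes L: "bounded_linear L"
    and A: "closed A" "convex A" "bounded A" and B: "closed B" "convex B" "bounded B"
  shows "closed {w - L u | u w. u \<in> A \<and> w \<in> B}"
proof -
  interpret bounded_linear L by fact
  let ?D = "{w - L u | u w. u \<in> A \<and> w \<in> B}"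
  have "y \<in> ?D" if y: "y \<in> closure ?D" for y
  proof -
    define C where "C n = {v \<in> A \<times> B. norm (snd v - L (fst v) - y) \<le> 1 / real (Suc n)}" for n
    have "\<exists>v. \<forall>n. v \<in> C n"
    proof (rule nested_convex_Inter_nonempty)
      fix n
      have "continuous_on (A \<times> B) (\<lambda>v. norm (snd v - L (fst v) - y))"
        by (intro continuous_intros bounded_linear.continuous_on[OF L])
      then have "closed ((A \<times> B) \<inter> (\<lambda>v. norm (snd v - L (fst v) - y)) -` {..1 / real (Suc n)})"
        by (intro continuous_closed_preimage closed_Times A B) auto
      then show "closed (C n)" by (simp add: C_def vimage_def Int_def)
      have "linear (\<lambda>v::'a \<times> 'b. snd v - L (fst v))"
        by (intro linearI) (auto simp: add scale algebra_simps)
      then have "convex ((\<lambda>v. snd v - L (fst v)) -` cball y (1 / real (Suc n)))"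
        by (intro convex_linear_vimage convex_cball)
      then have "convex ((A \<times> B) \<inter> (\<lambda>v. snd v - L (fst v)) -` cball y (1 / real (Suc n)))"
        by (intro convex_Int convex_Times A B)
      then show "convex (C n)"
        by (simp add: C_def vimage_def Int_def dist_norm norm_minus_commute)
      have "\<exists>x\<in>?D. dist x y < 1 / real (Suc n)"
        using y unfolding closure_approachable by (simp del: of_nat_Suc)
      then obtain u w where "u \<in> A" "w \<in> B" "norm (w - L u - y) < 1 / real (Suc n)"
        by (auto simp: dist_norm)
      then have "(u, w) \<in> C n" by (simp add: C_def)
      then show "C n \<noteq> {}" by blast
    next
      show "decseq C"
      proof (rule decseq_SucI)
        fix n
        have "1 / real (Suc (Suc n)) \<le> 1 / real (Suc n)" by (simp add: field_simps)
        then show "C (Suc n) \<subseteq> C n" by (auto simp: C_def simp del: of_nat_Suc)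
      qed
    next
      show "bounded (C 0)"
        by (rule bounded_subset[OF bounded_Times[OF A(3) B(3)]]) (auto simp: C_def)
    qed
    then obtain u w where uw: "\<And>n. (u, w) \<in> C n" by auto
    have "norm (w - L u - y) \<le> 0"
      by (rule Lim_bounded2[OF LIMSEQ_Suc[OF lim_1_over_n], where N = 0])
        (use uw in \<open>auto simp: C_def\<close>)
    then show ?thesis using uw by (auto simp: C_def)
  qed
  then have "closure ?D \<subseteq> ?D" by (intro subsetI)
  then show ?thesis by (simp only: closure_subset_eq)
qed

lemma convex_sublevel:
  assumes "convex_ereal f"
  shows "convex {x. f x \<le> ereal c}"
proof -
  have "{x. f x \<le> ereal c} = fst ` (epi f \<inter> UNIV \<times> {..c})"
    by (force simp: mem_epi intro: order_trans)
  then show ?thesis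
    using convex_epi[OF assms]
    by (auto intro!: convex_linear_image linear_fst convex_Int convex_Times)
qed

lemma closed_sublevel:
  fixes f :: "'a::metric_space \<Rightarrow> ereal"
  assumes "lsc f"
  shows "closed {x. f x \<le> ereal c}"
proof -
  have "{x. f x \<le> ereal c} = (\<lambda>x. (x, c)) -` epi f" by (auto simp: mem_epi)
  then show ?thesis by (simp add: closed_vimage[OF closed_epi[OF assms]] continuous_on_Pair)
qed

text \<open>The sets \<open>A n\<close> are closed, convex and increasing, and they cover a neighbourhood of \<open>0\<close>.  By Baire
one of them contains a ball; averaging this ball with a point of some \<open>A m\<close> on the opposite side
of \<open>0\<close> moves it to a ball around \<open>0\<close>.\<close>

lemma bounded_near_zero_regularity2:
  fixes g :: "'a::{real_inner, complete_space} \<Rightarrow> ereal"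
    and f :: "'b::{real_inner, complete_space} \<Rightarrow> ereal"
  assumes g: "proper g" "convex_ereal g" "lsc g"
    and f: "proper f" "convex_ereal f" "lsc f"
    and L: "bounded_linear L"
    and reg: "regularity2 g f L"
  shows "\<exists>dlt>0. \<exists>M. \<forall>y. norm y < dlt \<longrightarrow>
           (\<exists>u w. w - L u = y \<and> g u \<le> ereal M \<and> f w \<le> ereal M)"
proof -
  define A where "A n = {w - L u | u w. u \<in> cball 0 (real n) \<inter> {u. g u \<le> ereal (real n)} \<and>
      w \<in> cball 0 (real n) \<inter> {w. f w \<le> ereal (real n)}}" for n
  have A_closed: "closed (A n)" for n
    unfolding A_def using g f
    by (intro closed_difference_image L closed_Int convex_Int closed_sublevel convex_sublevel
        bounded_Int disjI1) auto
  have A_convex: "convex (A n)" for n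
    unfolding A_def using g f bounded_linear.linear[OF L]
    by (intro convex_difference_image convex_Int convex_sublevel) auto
  have A_mono: "A n \<subseteq> A m" if "n \<le> m" for n m
    using that unfolding A_def by (fastforce intro: order_trans)
  obtain \<rho> where \<rho>: "\<rho> > 0"
    and near: "ball 0 \<rho> \<subseteq> {L x - y | x y. x \<in> effdom g \<and> y \<in> effdom f}"
    using reg unfolding regularity2_def mem_interior by blast
  have cover: "\<exists>n. y \<in> A n" if y: "norm y < \<rho>" for y
  proof -
    have "- y \<in> ball 0 \<rho>" using y by simp
    then obtain u w where uw: "- y = L u - w" "u \<in> effdom g" "w \<in> effdom f"
      using near by blast
    obtain r s where r: "g u = ereal r" and s: "f w = ereal s"
      using uw g(1) f(1) unfolding effdom_def by (metis mem_Collect_eq proper_finite_below)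
    obtain n where n: "max (max (norm u) (norm w)) (max r s) \<le> real n"
      using real_arch_simple by blast
    have "y = w - L u" using uw(1) by (metis minus_diff_eq minus_minus)
    then have "y \<in> A n"
      using n r s unfolding A_def by (intro CollectI exI[of _ u] exI[of _ w]) auto
    then show ?thesis ..
  qed
  have "\<exists>n. interior (A n) \<noteq> {}"
  proof (rule ccontr)
    assume "\<nexists>n. interior (A n) \<noteq> {}"
    then have "euclidean interior_of \<Union> (range A) = {}"
      using A_closed
      by (intro Baire_category_alt disjI1 completely_metrizable_space_euclidean) auto
    moreover have "ball 0 \<rho> \<subseteq> interior (\<Union> (range A))"
      using cover by (intro interior_maximal) auto
    ultimately show False using \<rho> by auto
  qed
  then obtain n y0 \<rho>' where \<rho>': "\<rho>' > 0" and ball: "ball y0 \<rho>' \<subseteq> A n"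
    by (metis all_not_in_conv mem_interior)
  \<comment> \<open>The factor \<open>s\<close> is small enough for \<open>- s *\<^sub>R y0\<close> to lie in the neighbourhood covered.\<close>
  define s where "s = \<rho> / (2 * (norm y0 + 1))"
  have s: "s > 0" using \<rho> by (simp add: s_def add_nonneg_pos)
  have "s * norm y0 < \<rho>"
  proof -
    have "\<rho> * norm y0 < \<rho> * (2 * (norm y0 + 1))" using \<rho>
      by (intro mult_strict_left_mono) (smt (verit) norm_ge_zero, simp)
    then show ?thesis
      using add_nonneg_pos[OF norm_ge_zero[of y0] zero_less_one]
      by (simp add: s_def pos_divide_less_eq)
  qed
  then obtain m where m: "- (s *\<^sub>R y0) \<in> A m"
    using cover[of "- (s *\<^sub>R y0)"] s by auto
  define N where "N = max n m"
  define dlt where "dlt = s * \<rho>' / (1 + s)"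
  have "dlt > 0" using s \<rho>' by (simp add: dlt_def)
  moreover have "\<exists>u w. w - L u = y \<and> g u \<le> ereal (real N) \<and> f w \<le> ereal (real N)"
    if y: "norm y < dlt" for y
  proof -
    define y' where "y' = y0 + ((1 + s) / s) *\<^sub>R y"
    have "(1 + s) / s * norm y < \<rho>'"
      using y s by (simp add: dlt_def field_simps)
    then have "y' \<in> ball y0 \<rho>'" using s by (simp add: y'_def dist_norm)
    then have "y' \<in> A N" using ball A_mono[of n N] by (auto simp: N_def)
    moreover have "- (s *\<^sub>R y0) \<in> A N" using m A_mono[of m N] by (auto simp: N_def)
    ultimately have "(s / (1 + s)) *\<^sub>R y' + (1 / (1 + s)) *\<^sub>R (- (s *\<^sub>R y0)) \<in> A N"
      using s by (intro convexD[OF A_convex]) (auto simp: field_simps)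
    moreover have "(s / (1 + s)) *\<^sub>R y' + (1 / (1 + s)) *\<^sub>R (- (s *\<^sub>R y0)) = y"
      using s by (simp add: y'_def scaleR_add_right)
    ultimately have "y \<in> A N" by simp
    then show ?thesis unfolding A_def by auto
  qed
  ultimately show ?thesis
    by (intro exI[of _ dlt] conjI exI[of _ "real N"] allI impI)
qed

lemma bounded_near_zero_regularity:
  fixes g :: "'a::{real_inner, complete_space} \<Rightarrow> ereal"
    and f :: "'b::{real_inner, complete_space} \<Rightarrow> ereal"
  assumes g: "proper g" "convex_ereal g" "lsc g"
    and f: "proper f" "convex_ereal f" "lsc f"
    and L: "bounded_linear L"
    and reg: "regularity1 g f L \<or> regularity2 g f L"
  shows "\<exists>dlt>0. \<exists>M. \<forall>y. norm y < dlt \<longrightarrow>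
           (\<exists>u w. w - L u = y \<and> g u \<le> ereal M \<and> f w \<le> ereal M)"
  using reg
proof
  assume "regularity1 g f L"
  then obtain x where x: "g x < \<infinity>" "f (L x) < \<infinity>" and cont: "isCont f (L x)"
    by (auto simp: regularity1_def effdom_def)
  obtain r s where r: "g x = ereal r" and s: "f (L x) = ereal s"
    using proper_finite_below[OF g(1) x(1)] proper_finite_below[OF f(1) x(2)] by metis
  have "\<forall>\<^sub>F z in nhds (L x). f z < ereal (s + 1)"
  proof (rule order_tendstoD(2))
    show "(f \<longlongrightarrow> f (L x)) (nhds (L x))"
      using cont by (simp add: isCont_def tendsto_at_iff_tendsto_nhds)
    show "f (L x) < ereal (s + 1)" by (simp add: s)
  qed
  then obtain dlt where dlt: "dlt > 0" "\<And>z. dist z (L x) < dlt \<Longrightarrow> f z < ereal (s + 1)"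
    by (auto simp: eventually_nhds_metric)
  have "\<exists>u w. w - L u = y \<and> g u \<le> ereal (max r (s + 1)) \<and> f w \<le> ereal (max r (s + 1))"
    if "norm y < dlt" for y
  proof (intro exI conjI)
    show "(L x + y) - L x = y" by simp
    show "g x \<le> ereal (max r (s + 1))" by (simp add: r)
    have "f (L x + y) < ereal (s + 1)" using that by (intro dlt(2)) (simp add: dist_norm)
    also have "\<dots> \<le> ereal (max r (s + 1))" by simp
    finally show "f (L x + y) \<le> ereal (max r (s + 1))" by simp
  qed
  then show ?thesis using dlt(1) by blast
next
  assume "regularity2 g f L"
  then show ?thesis by (rule bounded_near_zero_regularity2[OF g f L])
qed

text \<open>The set \<open>E\<close> consists of the points above the graph of the perturbation function
\<open>y \<mapsto> inf\<^sub>u (g u + f (L u + y))\<close> minus its value \<open>r + s\<close> at \<open>0\<close>.  A linear minorant \<open>p\<close> of this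
function is a Lagrange multiplier: fixing one of the two variables at \<open>x\<close> or \<open>L x\<close> gives the two
inclusions.\<close>

lemma kkt_point_exists:
  fixes g :: "'a::{real_inner, complete_space} \<Rightarrow> ereal"
    and f :: "'b::{real_inner, complete_space} \<Rightarrow> ereal"
  assumes g: "proper g" "convex_ereal g" "lsc g"
    and f: "proper f" "convex_ereal f" "lsc f"
    and L: "bounded_linear L"
    and reg: "regularity1 g f L \<or> regularity2 g f L"
    and x: "primal_solution g f L x"
  shows "\<exists>p. kkt_point g f L x p"
proof -
  interpret bounded_linear L by fact
  obtain dlt M where dlt: "dlt > 0" and bound': "\<forall>y. norm y < dlt \<longrightarrow>
      (\<exists>u w. w - L u = y \<and> g u \<le> ereal M \<and> f w \<le> ereal M)"
    using bounded_near_zero_regularity[OF g f L reg] by (elim exE conjE)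
  note bound = bound'[rule_format]
  have min: "g x + f (L x) \<le> g u + f (L u)" for u
    using x by (auto simp: primal_solution_def primal_objective_def is_arg_min_def not_less)
  obtain u0 where "g u0 \<le> ereal M" "f (L u0) \<le> ereal M"
    using bound[of 0] dlt by auto
  then have "g u0 + f (L u0) \<le> ereal M + ereal M" by (rule add_mono)
  then have "g x + f (L x) \<le> ereal (M + M)" using order_trans[OF min[of u0]] by simp
  then have fin: "g x < \<infinity>" "f (L x) < \<infinity>" using g(1) f(1) by (auto simp: proper_def)
  obtain r s where r: "g x = ereal r" and s: "f (L x) = ereal s"
    using proper_finite_below[OF g(1) fin(1)] proper_finite_below[OF f(1) fin(2)] by metis
  define E where "E = {(w - L u, a + c - (r + s)) | u a w c. (u, a) \<in> epi g \<and> (w, c) \<in> epi f}"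
  have "\<exists>p. \<forall>y a. (y, a) \<in> E \<longrightarrow> p \<bullet> y \<le> a"
  proof (rule supporting_functional_at_zero[where dlt = "dlt / 2" and M = "M + M - (r + s)"])
    have "linear (\<lambda>v::'a \<times> real. (L (fst v), - snd v))"
      by (intro linearI) (auto simp: add scale)
    then have "convex {w - (L (fst v), - snd v) | v w. v \<in> epi g \<and> w \<in> epi f}"
      by (intro convex_difference_image convex_epi g f)
    then have "convex ((+) (0, - (r + s)) ` {w - (L (fst v), - snd v) | v w. v \<in> epi g \<and> w \<in> epi f})"
      by (rule convex_translation)
    also have "(+) (0, - (r + s)) ` {w - (L (fst v), - snd v) | v w. v \<in> epi g \<and> w \<in> epi f} = E"
    proof (intro subset_antisym subsetI)
      fix z
      assume "z \<in> (+) (0, - (r + s)) ` {w - (L (fst v), - snd v) | v w. v \<in> epi g \<and> w \<in> epi f}"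
      then obtain v w where vw: "v \<in> epi g" "w \<in> epi f"
        and z: "z = (0, - (r + s)) + (w - (L (fst v), - snd v))" by blast
      obtain u a y c where "v = (u, a)" "w = (y, c)" by (cases v, cases w)
      then have "z = (y - L u, a + c - (r + s))" "(u, a) \<in> epi g" "(y, c) \<in> epi f"
        using vw z by simp_all
      then show "z \<in> E" unfolding E_def by blast
    next
      fix z assume "z \<in> E"
      then obtain u a w c where uw: "(u, a) \<in> epi g" "(w, c) \<in> epi f"
        and z: "z = (w - L u, a + c - (r + s))" by (auto simp: E_def)
      have "z = (0, - (r + s)) + ((w, c) - (L (fst (u, a)), - snd (u, a)))" by (simp add: z)
      then show "z \<in> (+) (0, - (r + s)) ` {w - (L (fst v), - snd v) | v w. v \<in> epi g \<and> w \<in> epi f}"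
        using uw by blast
    qed
    finally show "convex E" .
  next
    fix y a c assume "(y, a) \<in> E" "a \<le> c"
    then obtain u a' w c' where *: "y = w - L u" "a = a' + c' - (r + s)"
      "(u, a') \<in> epi g" "(w, c') \<in> epi f" by (auto simp: E_def)
    have "f w \<le> ereal (c' + (c - a))"
      using *(4) \<open>a \<le> c\<close> by (auto simp: mem_epi intro: order_trans)
    then have "(w - L u, a' + (c' + (c - a)) - (r + s)) \<in> E"
      using *(3) unfolding E_def mem_epi by blast
    then show "(y, c) \<in> E" using * by simp
  next
    fix a assume "(0, a) \<in> E"
    then obtain u a' c' where *: "a = a' + c' - (r + s)" "g u \<le> ereal a'" "f (L u) \<le> ereal c'"
      by (auto simp: E_def mem_epi)
    have "ereal (r + s) \<le> g u + f (L u)" using min[of u] r s by simp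
    also have "\<dots> \<le> ereal a' + ereal c'" using * by (intro add_mono) auto
    finally show "0 \<le> a" using * by simp
  next
    fix y :: 'b assume "norm y \<le> dlt / 2"
    then obtain u w where "w - L u = y" "g u \<le> ereal M" "f w \<le> ereal M"
      using bound[of y] dlt by fastforce
    then show "(y, M + M - (r + s)) \<in> E" unfolding E_def mem_epi by blast
  qed (use dlt in simp)
  then obtain p where p: "\<And>u a w c. g u \<le> ereal a \<Longrightarrow> f w \<le> ereal c \<Longrightarrow>
      p \<bullet> (w - L u) \<le> a + c - (r + s)"
    unfolding E_def mem_epi by blast
  have "p \<in> subdifferential f (L x)"
    unfolding subdifferential_iff_epi mem_epi using p[of x r] r s by fastforce
  moreover have "- adjoint L p \<in> subdifferential g x"
    unfolding subdifferential_iff_epi mem_epi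
    using p[of _ _ "L x" s] r s by (fastforce simp: adjoint_inner[OF L] diff inner_diff_right)
  ultimately show ?thesis by (auto simp: kkt_point_def)
qed

lemma kkt_point_primal_solution:
  fixes g :: "'a::{real_inner, complete_space} \<Rightarrow> ereal"
    and f :: "'b::{real_inner, complete_space} \<Rightarrow> ereal"
  assumes L: "bounded_linear L" and kkt: "kkt_point g f L x p"
  shows "primal_solution g f L x"
proof -
  interpret bounded_linear L by fact
  have "g x + f (L x) \<le> g y + f (L y)" for y
  proof -
    have g: "g x + ereal (- adjoint L p \<bullet> (y - x)) \<le> g y"
      and f: "f (L x) + ereal (p \<bullet> (L y - L x)) \<le> f (L y)"
      and fin: "\<bar>g x\<bar> \<noteq> \<infinity>" "\<bar>f (L x)\<bar> \<noteq> \<infinity>"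
      using kkt by (auto simp: kkt_point_def subdifferential_def)
    have "- adjoint L p \<bullet> (y - x) = - (p \<bullet> (L y - L x))"
      by (simp add: adjoint_inner[OF L] diff)
    then show ?thesis
      using add_mono[OF g f] fin by (cases "g x"; cases "f (L x)") auto
  qed
  then show ?thesis
    by (auto simp: primal_solution_def primal_objective_def is_arg_min_def not_less)
qed

section \<open>The alternating split Bregman iteration\<close>

lemma tendsto_zero_of_norm_square_le:
  fixes x :: "nat \<Rightarrow> 'a::real_normed_vector"
  assumes "\<And>n. (norm (x n))\<^sup>2 \<le> c n" "c \<longlonglongrightarrow> 0"
  shows "x \<longlonglongrightarrow> 0"
proof -
  have "(\<lambda>n. sqrt (c n)) \<longlonglongrightarrow> sqrt 0" by (intro tendsto_intros assms(2))
  moreover have "norm (x n) \<le> sqrt (c n)" for n using assms(1) by (rule real_le_rsqrt)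
  ultimately show ?thesis
    by (auto intro: Lim_null_comparison[of x "\<lambda>n. sqrt (c n)"] always_eventually)
qed

lemma tendsto_zero_inner_bounded:
  fixes x y :: "nat \<Rightarrow> 'a::real_inner"
  assumes "x \<longlonglongrightarrow> 0" "\<And>n. norm (y n) \<le> B"
  shows "(\<lambda>n. x n \<bullet> y n) \<longlonglongrightarrow> 0"
proof (rule Lim_null_comparison)
  show "\<forall>\<^sub>F n in sequentially. norm (x n \<bullet> y n) \<le> norm (x n) * B"
    using assms(2) by (intro always_eventually allI)
      (metis Cauchy_Schwarz_ineq2 mult_left_mono norm_ge_zero order_trans real_norm_def)
  show "(\<lambda>n. norm (x n) * B) \<longlonglongrightarrow> 0"
    using tendsto_mult_left_zero[OF tendsto_norm_zero[OF assms(1)]] by simp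
qed

text \<open>The two sides differ by exactly twice the inner product in the assumption.\<close>

lemma fejer_step:
  fixes B D x :: "'a::real_inner"
  assumes "(B + x - D) \<bullet> x \<le> 0"
  shows "(norm (B + x))\<^sup>2 + (norm (D - x))\<^sup>2 + 2 * (B \<bullet> D) \<le> (norm (B + D))\<^sup>2"
proof -
  have "(norm (B + x))\<^sup>2 + (norm (D - x))\<^sup>2 + 2 * (B \<bullet> D) - (norm (B + D))\<^sup>2
      = 2 * ((B + x - D) \<bullet> x)"
    unfolding power2_norm_eq_inner
    by (simp add: inner_add_left inner_add_right inner_diff_left inner_diff_right inner_commute)
  then show ?thesis using assms by linarith
qed

locale split_bregman_iteration =
  fixes g :: "'a::{real_inner, complete_space} \<Rightarrow> ereal"
    and f :: "'b::{real_inner, complete_space} \<Rightarrow> ereal"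
    and L :: "'a \<Rightarrow> 'b"
    and lam :: real
    and u :: "nat \<Rightarrow> 'a"
    and d b :: "nat \<Rightarrow> 'b"
  assumes g: "proper g" "convex_ereal g" "lsc g"
    and f: "proper f" "convex_ereal f" "lsc f"
    and L: "bounded_linear L"
    and lam: "lam > 0"
    and iterates: "split_bregman g f L lam u d b"
begin

sublocale L: bounded_linear L by (rule L)

lemma b_step: "b (Suc k) = b k + L (u (Suc k)) - d (Suc k)"
  using iterates[unfolded split_bregman_def, rule_format, of "Suc k"] by simp

lemma u_step: "- adjoint L (lam *\<^sub>R (b k + L (u (Suc k)) - d k)) \<in> subdifferential g (u (Suc k))"
proof -
  have "I1 g L lam (b k) (d k) = (\<lambda>v. g v + ereal (lam / 2 * (norm ((b k - d k) + L v))\<^sup>2))"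
    by (simp add: I1_def algebra_simps fun_eq_iff)
  then have "minimizer (\<lambda>v. g v + ereal (lam / 2 * (norm ((b k - d k) + L v))\<^sup>2)) (u (Suc k))"
    using iterates[unfolded split_bregman_def, rule_format, of "Suc k"] by simp
  then obtain r where r: "g (u (Suc k)) = ereal r"
    and le: "\<And>y s. (y, s) \<in> epi g \<Longrightarrow>
      r - lam * (((b k - d k) + L (u (Suc k))) \<bullet> L (y - u (Suc k))) \<le> s"
    using minimizer_plus_square_subgradient[OF g(1,2) L.linear_axioms] by blast
  have c: "b k - d k + L (u (Suc k)) = b k + L (u (Suc k)) - d k" by simp
  have "r + - adjoint L (lam *\<^sub>R (b k + L (u (Suc k)) - d k)) \<bullet> (y - u (Suc k)) \<le> s"
    if "(y, s) \<in> epi g" for y s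
    using le[OF that, unfolded c] by (simp add: adjoint_inner[OF L])
  then show ?thesis using r unfolding subdifferential_iff_epi by blast
qed

lemma d_step: "lam *\<^sub>R b (Suc k) \<in> subdifferential f (d (Suc k))"
proof -
  have "minimizer (\<lambda>v. f v + ereal (lam / 2 * (norm ((b k + L (u (Suc k))) + - v))\<^sup>2)) (d (Suc k))"
    using iterates[unfolded split_bregman_def, rule_format, of "Suc k"]
    unfolding I2_def by simp
  moreover have "linear (uminus :: 'b \<Rightarrow> 'b)" by (rule linear_uminus)
  ultimately obtain r where r: "f (d (Suc k)) = ereal r"
    and le: "\<And>y s. (y, s) \<in> epi f \<Longrightarrow>
      r - lam * (((b k + L (u (Suc k))) + - d (Suc k)) \<bullet> - (y - d (Suc k))) \<le> s"
    using minimizer_plus_square_subgradient[OF f(1,2)] by blast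
  moreover have "b k + L (u (Suc k)) + - d (Suc k) = b (Suc k)" by (simp add: b_step)
  ultimately have "r + (lam *\<^sub>R b (Suc k)) \<bullet> (y - d (Suc k)) \<le> s" if "(y, s) \<in> epi f" for y s
    using le[OF that] by (simp add: algebra_simps)
  then show ?thesis using r unfolding subdifferential_iff_epi by blast
qed

text \<open>The index is shifted because \<open>d 0\<close> and \<open>b 0\<close> are arbitrary: they need not be a subgradient pair of \<open>f\<close>.\<close>

lemma kkt_monotone_b_d:
  assumes "kkt_point g f L x (lam *\<^sub>R p)"
  shows "0 \<le> (b (Suc k) - p) \<bullet> (d (Suc k) - L x)"
  using subdifferential_monotone[OF d_step[of k]] assms lam
  by (force simp: kkt_point_def zero_le_mult_iff simp flip: scaleR_diff_right)

text \<open>Monotonicity of the subdifferential of \<open>g\<close> is the assumption of \<open>fejer_step\<close> for the deviations \<open>B\<close>,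
\<open>D\<close>, \<open>z\<close> from the saddle point, and \<open>B + z\<close> is the next deviation of \<open>b + d\<close>.\<close>

lemma fejer_descent:
  assumes kkt: "kkt_point g f L x (lam *\<^sub>R p)"
  shows "(norm (b (Suc (Suc k)) + d (Suc (Suc k)) - (p + L x)))\<^sup>2
      + (norm (d (Suc k) - L (u (Suc (Suc k)))))\<^sup>2
      + 2 * ((b (Suc k) - p) \<bullet> (d (Suc k) - L x))
    \<le> (norm (b (Suc k) + d (Suc k) - (p + L x)))\<^sup>2"
proof -
  define B D z where "B = b (Suc k) - p" and "D = d (Suc k) - L x"
    and "z = L (u (Suc (Suc k))) - L x"
  have "0 \<le> (- adjoint L (lam *\<^sub>R (b (Suc k) + L (u (Suc (Suc k))) - d (Suc k)))
      - - adjoint L (lam *\<^sub>R p)) \<bullet> (u (Suc (Suc k)) - x)"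
    using u_step kkt unfolding kkt_point_def by (intro subdifferential_monotone) auto
  also have "\<dots> = - lam * ((B + z - D) \<bullet> z)"
    by (simp add: B_def D_def z_def adjoint_inner[OF L] L.diff algebra_simps)
  finally have "(B + z - D) \<bullet> z \<le> 0"
    using lam by (simp add: mult_le_0_iff)
  from fejer_step[OF this] show ?thesis
    by (simp add: B_def D_def z_def b_step[of "Suc k"] algebra_simps)
qed

lemma fejer_mono:
  assumes "kkt_point g f L x (lam *\<^sub>R p)"
  shows "(norm (b (Suc (Suc k)) + d (Suc (Suc k)) - (p + L x)))\<^sup>2
      + (norm (d (Suc k) - L (u (Suc (Suc k)))))\<^sup>2
    \<le> (norm (b (Suc k) + d (Suc k) - (p + L x)))\<^sup>2"
  using fejer_descent[OF assms, of k] kkt_monotone_b_d[OF assms, of k] by linarith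

lemma distance_convergent:
  assumes "kkt_point g f L x (lam *\<^sub>R p)"
  shows "convergent (\<lambda>k. (norm (b (Suc k) + d (Suc k) - (p + L x)))\<^sup>2)"
proof -
  have "decseq (\<lambda>k. (norm (b (Suc k) + d (Suc k) - (p + L x)))\<^sup>2)"
    using fejer_mono[OF assms] by (intro decseq_SucI) (smt (verit) zero_le_power2)
  from decseq_convergent[OF this, of 0] show ?thesis by (auto intro: convergentI)
qed

lemma summable_residual:
  assumes kkt: "kkt_point g f L x (lam *\<^sub>R p)"
  shows "summable (\<lambda>k. (norm (d k - L (u (Suc k))))\<^sup>2)"
proof -
  define e where "e k = (norm (b (Suc k) + d (Suc k) - (p + L x)))\<^sup>2" for k
  have "(\<Sum>k<n. (norm (d (Suc k) - L (u (Suc (Suc k)))))\<^sup>2) \<le> e 0 - e n" for n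
  proof (induction n)
    case (Suc n)
    then show ?case using fejer_mono[OF kkt, of n] by (simp add: e_def)
  qed simp
  moreover have "e n \<ge> 0" for n by (simp add: e_def)
  ultimately have "(\<Sum>k<n. (norm (d (Suc k) - L (u (Suc (Suc k)))))\<^sup>2) \<le> e 0" for n
    by (smt (verit))
  then have "summable (\<lambda>k. (norm (d (Suc k) - L (u (Suc (Suc k)))))\<^sup>2)"
    by (intro summableI_nonneg_bounded[where x = "e 0"]) auto
  then show ?thesis
    using summable_Suc_iff[of "\<lambda>k. (norm (d k - L (u (Suc k))))\<^sup>2"] by simp
qed

lemma residual_tendsto_zero:
  assumes "kkt_point g f L x (lam *\<^sub>R p)"
  shows "(\<lambda>k. d k - L (u (Suc k))) \<longlonglongrightarrow> 0"
  by (rule tendsto_zero_of_norm_square_le[OF order_refl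
        summable_LIMSEQ_zero[OF summable_residual[OF assms]]])

text \<open>The increment of \<open>b + d\<close> equals the negative residual, and monotonicity of the subdifferential of \<open>f\<close>
makes the increments of \<open>b\<close> and \<open>d\<close> have nonnegative inner product, so each is at most as long as
their sum.\<close>

lemma increments_tendsto_zero:
  assumes "kkt_point g f L x (lam *\<^sub>R p)"
  shows "(\<lambda>k. b (Suc k) - b k) \<longlonglongrightarrow> 0" and "(\<lambda>k. d (Suc k) - d k) \<longlonglongrightarrow> 0"
proof -
  have split: "(norm (b (Suc (Suc k)) - b (Suc k)))\<^sup>2 + (norm (d (Suc (Suc k)) - d (Suc k)))\<^sup>2
      \<le> (norm (d (Suc k) - L (u (Suc (Suc k)))))\<^sup>2" for k
  proof -
    let ?b = "b (Suc (Suc k)) - b (Suc k)" and ?d = "d (Suc (Suc k)) - d (Suc k)"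
    have "0 \<le> ?b \<bullet> ?d"
      using subdifferential_monotone[OF d_step[of "Suc k"] d_step[of k]] lam
      by (simp add: zero_le_mult_iff flip: scaleR_diff_right)
    moreover have "d (Suc k) - L (u (Suc (Suc k))) = - (?b + ?d)"
      by (simp add: b_step[of "Suc k"])
    then have "(norm (d (Suc k) - L (u (Suc (Suc k)))))\<^sup>2 = (norm (?b + ?d))\<^sup>2"
      by (metis norm_minus_cancel)
    moreover have "(norm (?b + ?d))\<^sup>2 = (norm ?b)\<^sup>2 + 2 * (?b \<bullet> ?d) + (norm ?d)\<^sup>2"
      using norm_add_scaleR_square[of ?b 1 ?d] by simp
    ultimately show ?thesis by linarith
  qed
  have lim: "(\<lambda>k. (norm (d (Suc k) - L (u (Suc (Suc k)))))\<^sup>2) \<longlonglongrightarrow> 0"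
    using LIMSEQ_Suc[OF summable_LIMSEQ_zero[OF summable_residual[OF assms]]] .
  have "(\<lambda>k. b (Suc (Suc k)) - b (Suc k)) \<longlonglongrightarrow> 0"
    by (rule tendsto_zero_of_norm_square_le[OF _ lim])
      (use split in \<open>smt (verit) zero_le_power2\<close>)
  then show "(\<lambda>k. b (Suc k) - b k) \<longlonglongrightarrow> 0"
    using filterlim_sequentially_Suc[of "\<lambda>k. b (Suc k) - b k"] by simp
  have "(\<lambda>k. d (Suc (Suc k)) - d (Suc k)) \<longlonglongrightarrow> 0"
    by (rule tendsto_zero_of_norm_square_le[OF _ lim])
      (use split in \<open>smt (verit) zero_le_power2\<close>)
  then show "(\<lambda>k. d (Suc k) - d k) \<longlonglongrightarrow> 0"
    using filterlim_sequentially_Suc[of "\<lambda>k. d (Suc k) - d k"] by simp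
qed

text \<open>Fejer monotonicity bounds \<open>b + d\<close>; the nonnegative inner product of the deviations of \<open>b\<close> and \<open>d\<close>
lets this bound both of them.\<close>

lemma iterates_bounded:
  assumes kkt: "kkt_point g f L x (lam *\<^sub>R p)"
  obtains B where "\<And>k. norm (b (Suc k), d (Suc k)) \<le> B"
proof -
  define e where "e k = (norm (b (Suc k) + d (Suc k) - (p + L x)))\<^sup>2" for k
  have "decseq e"
    using fejer_mono[OF kkt] unfolding e_def by (intro decseq_SucI) (smt (verit) zero_le_power2)
  then have e: "e k \<le> e 0" for k by (simp add: decseq_def)
  have "norm (b (Suc k), d (Suc k)) \<le> norm (p, L x) + sqrt (e 0)" for k
  proof -
    let ?b = "b (Suc k) - p" and ?d = "d (Suc k) - L x"
    have "(norm (?b + ?d))\<^sup>2 = (norm ?b)\<^sup>2 + 2 * (?b \<bullet> ?d) + (norm ?d)\<^sup>2"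
      using norm_add_scaleR_square[of ?b 1 ?d] by simp
    moreover have "?b + ?d = b (Suc k) + d (Suc k) - (p + L x)" by simp
    ultimately have "(norm ?b)\<^sup>2 + (norm ?d)\<^sup>2 \<le> e k"
      using kkt_monotone_b_d[OF kkt, of k] by (simp add: e_def)
    then have "norm (?b, ?d) \<le> sqrt (e 0)"
      using e[of k] by (simp add: norm_Pair)
    moreover have "(b (Suc k), d (Suc k)) = (p, L x) + (?b, ?d)" by simp
    then have "norm (b (Suc k), d (Suc k)) \<le> norm (p, L x) + norm (?b, ?d)"
      by (metis norm_triangle_ineq)
    ultimately show ?thesis by linarith
  qed
  then show ?thesis by (rule that)
qed

text \<open>The inequality holds for the iterates up to a null sequence, by the Fenchel inequality at \<open>y\<close> and
\<open>z\<close> and the subgradient inequalities at \<open>v\<close> and \<open>w\<close>; \<open>X k\<close> is written in terms of the increments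
\<open>\<beta>\<close> and \<open>\<delta>\<close> such that every product of two iterates contains a null factor.  All other terms are
linear in the iterates, so they pass to the weak limit.\<close>

lemma weak_cluster_inequality:
  assumes kkt: "kkt_point g f L x (lam *\<^sub>R p)"
    and G: "G \<le> sequentially" "G \<noteq> bot"
    and bG: "\<And>h. ((\<lambda>k. b (Suc k) \<bullet> h) \<longlongrightarrow> bb \<bullet> h) G"
    and dG: "\<And>h. ((\<lambda>k. d (Suc k) \<bullet> h) \<longlongrightarrow> dd \<bullet> h) G"
    and c: "conjugate g (- adjoint L y) \<le> ereal c" and c': "conjugate f z \<le> ereal c'"
    and v: "(v, r) \<in> epi g" and w: "(w, s) \<in> epi f"
  shows "(- adjoint L (lam *\<^sub>R bb) \<bullet> v - r) + ((lam *\<^sub>R bb) \<bullet> w - s) \<le> c + c' + (y - z) \<bullet> dd"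
proof -
  define \<beta> \<delta> where "\<beta> k = b (Suc k) - b k" and "\<delta> k = d (Suc k) - d k" for k
  have null: "\<beta> \<longlonglongrightarrow> 0" "\<delta> \<longlonglongrightarrow> 0"
    using increments_tendsto_zero[OF kkt] by (simp_all add: \<beta>_def[abs_def] \<delta>_def[abs_def])
  have nullG: "((\<lambda>k. \<beta> k \<bullet> h) \<longlongrightarrow> 0) G" "((\<lambda>k. \<delta> k \<bullet> h) \<longlongrightarrow> 0) G" for h
    using tendsto_mono[OF G(1)] null tendsto_zero_inner_bounded[of _ "\<lambda>_. h" "norm h"] by blast+
  obtain B where B: "\<And>k. norm (b (Suc k), d (Suc k)) \<le> B" using iterates_bounded[OF kkt] by blast
  have bB: "norm (b (Suc k)) \<le> B" and dB: "norm (d (Suc k)) \<le> B" for k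
    using B[of k] norm_fst_le[of "b (Suc k)" "d (Suc k)"] norm_snd_le[of "d (Suc k)" "b (Suc k)"]
    by linarith+
  define X where "X k = - (y \<bullet> d (Suc k) + y \<bullet> \<beta> k) + z \<bullet> d (Suc k)
      - lam * (b (Suc k) \<bullet> L v + \<delta> k \<bullet> L v) + lam * (b (Suc k) \<bullet> w)
      + lam * (\<delta> k \<bullet> d (Suc k) + \<delta> k \<bullet> \<beta> k + \<beta> k \<bullet> b (Suc k))" for k
  have "((\<lambda>k. \<delta> k \<bullet> d (Suc k)) \<longlongrightarrow> 0) G" "((\<lambda>k. \<beta> k \<bullet> b (Suc k)) \<longlongrightarrow> 0) G"
    by (rule tendsto_mono[OF G(1) tendsto_zero_inner_bounded[OF null(2) dB]],
        rule tendsto_mono[OF G(1) tendsto_zero_inner_bounded[OF null(1) bB]])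
  moreover have "((\<lambda>k. \<delta> k \<bullet> \<beta> k) \<longlongrightarrow> 0) G"
    using tendsto_mono[OF G(1) tendsto_inner[OF null(2,1)]] by simp
  moreover have "((\<lambda>k. y \<bullet> d (Suc k)) \<longlongrightarrow> y \<bullet> dd) G" "((\<lambda>k. z \<bullet> d (Suc k)) \<longlongrightarrow> z \<bullet> dd) G"
    "((\<lambda>k. y \<bullet> \<beta> k) \<longlongrightarrow> 0) G"
    using dG[of y] dG[of z] nullG(1)[of y] by (simp_all add: inner_commute)
  ultimately have "(X \<longlongrightarrow> - (y \<bullet> dd + 0) + z \<bullet> dd - lam * (bb \<bullet> L v + 0) + lam * (bb \<bullet> w)
      + lam * (0 + 0 + 0)) G"
    unfolding X_def[abs_def]
    by (intro tendsto_add tendsto_diff tendsto_minus tendsto_mult_left bG nullG)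
  moreover have "X k \<le> c + c' + r + s" for k
  proof -
    let ?u = "u (Suc k)" and ?b = "b (Suc k)" and ?d = "d (Suc k)"
    have Lu: "L ?u = ?d + \<beta> k" by (simp add: \<beta>_def b_step[of k])
    have p: "b k + L ?u - d k = ?b + \<delta> k" by (simp add: \<delta>_def b_step[of k])
    obtain gu where gu: "g ?u = ereal gu"
      and gu_le: "gu + - adjoint L (lam *\<^sub>R (?b + \<delta> k)) \<bullet> (v - ?u) \<le> r"
      using u_step[of k] v unfolding subdifferential_iff_epi p by blast
    obtain fd where fd: "f ?d = ereal fd" and fd_le: "fd + (lam *\<^sub>R ?b) \<bullet> (w - ?d) \<le> s"
      using d_step[of k] w unfolding subdifferential_iff_epi by blast
    have "- adjoint L y \<bullet> ?u - gu \<le> c"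
      using c gu unfolding conjugate_le_iff_epi by (simp add: mem_epi)
    moreover have "z \<bullet> ?d - fd \<le> c'"
      using c' fd unfolding conjugate_le_iff_epi by (simp add: mem_epi)
    moreover have "X k = (- adjoint L y \<bullet> ?u) + z \<bullet> ?d
        + (- adjoint L (lam *\<^sub>R (?b + \<delta> k)) \<bullet> (v - ?u)) + (lam *\<^sub>R ?b) \<bullet> (w - ?d)"
    proof -
      have "- adjoint L y \<bullet> ?u = - (y \<bullet> ?d + y \<bullet> \<beta> k)"
        by (simp add: adjoint_inner[OF L] Lu inner_add_right)
      moreover have "- adjoint L (lam *\<^sub>R (?b + \<delta> k)) \<bullet> (v - ?u)
          = - lam * ((?b + \<delta> k) \<bullet> (L v - (?d + \<beta> k)))"
        by (simp only: inner_minus_left adjoint_inner[OF L] L.diff Lu inner_scaleR_left)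
      ultimately show ?thesis
        by (simp only: X_def) (simp add: inner_commute algebra_simps)
    qed
    ultimately show ?thesis using gu_le fd_le by linarith
  qed
  ultimately have "- (y \<bullet> dd + 0) + z \<bullet> dd - lam * (bb \<bullet> L v + 0) + lam * (bb \<bullet> w)
      + lam * (0 + 0 + 0) \<le> c + c' + r + s"
    using G(2) by (intro tendsto_upperbound) auto
  then show ?thesis by (simp add: adjoint_inner[OF L] inner_diff_left)
qed

text \<open>Taking suprema over \<open>(v, r)\<close> and \<open>(w, s)\<close> in \<open>weak_cluster_inequality\<close> turns its left-hand side into
the sum of the two conjugates at \<open>lam *\<^sub>R bb\<close>.  The choices \<open>z = lam *\<^sub>R bb\<close>, \<open>y = lam *\<^sub>R bb\<close>
and \<open>y = z\<close> give the three claims.\<close>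

lemma weak_cluster_dual:
  assumes kkt: "kkt_point g f L x (lam *\<^sub>R p)"
    and G: "G \<le> sequentially" "G \<noteq> bot"
    and bG: "\<And>h. ((\<lambda>k. b (Suc k) \<bullet> h) \<longlongrightarrow> bb \<bullet> h) G"
    and dG: "\<And>h. ((\<lambda>k. d (Suc k) \<bullet> h) \<longlongrightarrow> dd \<bullet> h) G"
  shows "- dd \<in> subdifferential (conjugate g \<circ> (\<lambda>q. - adjoint L q)) (lam *\<^sub>R bb)"
    and "dd \<in> subdifferential (conjugate f) (lam *\<^sub>R bb)"
    and "dual_solution g f L (lam *\<^sub>R bb)"
proof -
  let ?P = "lam *\<^sub>R bb"
  note ineq = weak_cluster_inequality[OF kkt G bG dG]
  \<comment> \<open>The known saddle point shows that both conjugates are finite at \<open>lam *\<^sub>R bb\<close>.\<close>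
  obtain c0 c0' where c0: "conjugate g (- adjoint L (lam *\<^sub>R p)) \<le> ereal c0"
    "conjugate f (lam *\<^sub>R p) \<le> ereal c0'"
    using kkt unfolding kkt_point_def by (metis subdifferential_conjugate_le)
  obtain v r w s where v: "(v, r) \<in> epi g" and w: "(w, s) \<in> epi f"
    using proper_finite_point[OF g(1)] proper_finite_point[OF f(1)] by (metis mem_epi order_refl)
  have "conjugate g (- adjoint L ?P) \<le> ereal (c0 + c0' - (?P \<bullet> w - s))"
    unfolding conjugate_le_iff_epi using ineq[OF c0 _ w] by fastforce
  then obtain cg where cg: "conjugate g (- adjoint L ?P) = ereal cg"
    using conjugate_finite[OF g(1)] by blast
  have "conjugate f ?P \<le> ereal (c0 + c0' - (- adjoint L ?P \<bullet> v - r))"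
    unfolding conjugate_le_iff_epi using ineq[OF c0 v] by fastforce
  then obtain cf where cf: "conjugate f ?P = ereal cf"
    using conjugate_finite[OF f(1)] by blast
  have main: "cg + cf \<le> c + c' + (y - z) \<bullet> dd"
    if c: "conjugate g (- adjoint L y) \<le> ereal c" and c': "conjugate f z \<le> ereal c'" for y z c c'
  proof -
    have "cg \<le> c + c' + (y - z) \<bullet> dd - (?P \<bullet> w - s)" if "(w, s) \<in> epi f" for w s
    proof -
      have "conjugate g (- adjoint L ?P) \<le> ereal (c + c' + (y - z) \<bullet> dd - (?P \<bullet> w - s))"
        unfolding conjugate_le_iff_epi using ineq[OF c c' _ that] by fastforce
      then show ?thesis by (simp add: cg)
    qed
    then have "conjugate f ?P \<le> ereal (c + c' + (y - z) \<bullet> dd - cg)"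
      unfolding conjugate_le_iff_epi by fastforce
    then show ?thesis by (simp add: cf)
  qed
  have "cg + - dd \<bullet> (y - ?P) \<le> c" if "conjugate g (- adjoint L y) \<le> ereal c" for y c
    using main[OF that, of ?P cf] cf by (simp add: inner_commute)
  then show "- dd \<in> subdifferential (conjugate g \<circ> (\<lambda>q. - adjoint L q)) ?P"
    unfolding subdifferential_iff_epi mem_epi using cg by simp
  have "cf + dd \<bullet> (z - ?P) \<le> c'" if "conjugate f z \<le> ereal c'" for z c'
    using main[OF _ that, of ?P cg] cg by (simp add: inner_commute inner_diff_right)
  then show "dd \<in> subdifferential (conjugate f) ?P"
    unfolding subdifferential_iff_epi mem_epi using cf by simp
  have "dual_objective g f L ?P \<le> dual_objective g f L y" for y
  proof (cases "conjugate g (- adjoint L y) = \<infinity> \<or> conjugate f y = \<infinity>")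
    case False
    then obtain c c' where "conjugate g (- adjoint L y) = ereal c" "conjugate f y = ereal c'"
      using conjugate_neq_MInf[OF g(1)] conjugate_neq_MInf[OF f(1)] by (metis ereal_cases)
    then show ?thesis using main[of y c y c'] by (simp add: dual_objective_def cg cf)
  qed (auto simp: dual_objective_def)
  then show "dual_solution g f L ?P"
    by (auto simp: dual_solution_def is_arg_min_def not_less)
qed

text \<open>Opial's argument: the squared distances of \<open>t k = b (Suc k) + d (Suc k)\<close> to \<open>t1\<close> and to \<open>t2\<close> both
converge, hence so does \<open>t k \<bullet> (t1 - t2)\<close>, and its limits along the two filters must agree.  This
gives \<open>t1 = t2\<close>; monotonicity of the subdifferential of \<open>f\<close> then separates the two summands.\<close>

lemma weak_cluster_unique:
  assumes k1: "kkt_point g f L x1 (lam *\<^sub>R b1)" and k2: "kkt_point g f L x2 (lam *\<^sub>R b2)"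
    and G1: "G1 \<le> sequentially" "G1 \<noteq> bot"
      "\<And>h. ((\<lambda>k. b (Suc k) \<bullet> h) \<longlongrightarrow> b1 \<bullet> h) G1"
      "\<And>h. ((\<lambda>k. d (Suc k) \<bullet> h) \<longlongrightarrow> L x1 \<bullet> h) G1"
    and G2: "G2 \<le> sequentially" "G2 \<noteq> bot"
      "\<And>h. ((\<lambda>k. b (Suc k) \<bullet> h) \<longlongrightarrow> b2 \<bullet> h) G2"
      "\<And>h. ((\<lambda>k. d (Suc k) \<bullet> h) \<longlongrightarrow> L x2 \<bullet> h) G2"
  shows "b1 = b2 \<and> L x1 = L x2"
proof -
  define t1 t2 where "t1 = b1 + L x1" and "t2 = b2 + L x2"
  define t where "t k = b (Suc k) + d (Suc k)" for k
  obtain l1 l2 where "(\<lambda>k. (norm (t k - t1))\<^sup>2) \<longlonglongrightarrow> l1" "(\<lambda>k. (norm (t k - t2))\<^sup>2) \<longlonglongrightarrow> l2"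
    using distance_convergent[OF k1] distance_convergent[OF k2]
    by (auto simp: t_def t1_def t2_def convergent_def)
  then have "(\<lambda>k. ((norm (t k - t2))\<^sup>2 - (norm (t k - t1))\<^sup>2 + t1 \<bullet> t1 - t2 \<bullet> t2) / 2)
      \<longlonglongrightarrow> (l2 - l1 + t1 \<bullet> t1 - t2 \<bullet> t2) / 2"
    by (intro tendsto_intros) auto
  moreover have "((norm (t k - t2))\<^sup>2 - (norm (t k - t1))\<^sup>2 + t1 \<bullet> t1 - t2 \<bullet> t2) / 2
      = t k \<bullet> (t1 - t2)" for k
    unfolding power2_norm_eq_inner
    by (simp add: inner_diff_left inner_diff_right inner_commute)
  ultimately have "(\<lambda>k. t k \<bullet> (t1 - t2)) \<longlonglongrightarrow> (l2 - l1 + t1 \<bullet> t1 - t2 \<bullet> t2) / 2" by simp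
  then have lims: "((\<lambda>k. t k \<bullet> (t1 - t2)) \<longlongrightarrow> (l2 - l1 + t1 \<bullet> t1 - t2 \<bullet> t2) / 2) G1"
    "((\<lambda>k. t k \<bullet> (t1 - t2)) \<longlongrightarrow> (l2 - l1 + t1 \<bullet> t1 - t2 \<bullet> t2) / 2) G2"
    using tendsto_mono G1(1) G2(1) by blast+
  have "((\<lambda>k. t k \<bullet> (t1 - t2)) \<longlongrightarrow> t1 \<bullet> (t1 - t2)) G1"
    "((\<lambda>k. t k \<bullet> (t1 - t2)) \<longlongrightarrow> t2 \<bullet> (t1 - t2)) G2"
    unfolding t_def t1_def t2_def inner_add_left
    by (rule tendsto_add[OF G1(3,4)], rule tendsto_add[OF G2(3,4)])
  with lims have "t1 \<bullet> (t1 - t2) = t2 \<bullet> (t1 - t2)"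
    using tendsto_unique G1(2) G2(2) by metis
  then have "(t1 - t2) \<bullet> (t1 - t2) = 0" by (simp add: inner_diff_left)
  then have "t1 = t2" by simp
  then have eq: "L x1 - L x2 = - (b1 - b2)" by (simp add: t1_def t2_def algebra_simps)
  have "0 \<le> (lam *\<^sub>R b1 - lam *\<^sub>R b2) \<bullet> (L x1 - L x2)"
    using k1 k2 unfolding kkt_point_def by (intro subdifferential_monotone) auto
  then have "lam * ((b1 - b2) \<bullet> (b1 - b2)) \<le> 0"
    unfolding eq by (simp only: scaleR_diff_right[symmetric] inner_scaleR_left inner_minus_right
        mult_minus_right neg_0_le_iff_le)
  then have "(b1 - b2) \<bullet> (b1 - b2) \<le> 0"
    using lam by (simp only: mult_le_0_iff) linarith
  then have "b1 - b2 = 0" by (metis inner_eq_zero_iff inner_ge_zero order_antisym)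
  then show ?thesis using eq by simp
qed

end

section \<open>Convergence of the algorithm\<close>

theorem theorem2p6:
  fixes g :: "'a::{real_inner, complete_space} \<Rightarrow> ereal"
    and f :: "'b::{real_inner, complete_space} \<Rightarrow> ereal"
    and L :: "'a \<Rightarrow> 'b"
    and lam :: real
    and u :: "nat \<Rightarrow> 'a"
    and d b :: "nat \<Rightarrow> 'b"
  assumes "proper g" "convex_ereal g" "lsc g"
    and "proper f" "convex_ereal f" "lsc f"
    and "bounded_linear L"
    and "lam > 0"
    and "\<exists>x. primal_solution g f L x"
    and "\<exists>p. dual_solution g f L p"
    and "regularity1 g f L \<or> regularity2 g f L"
    and "\<And>p. subdifferential (conjugate g \<circ> (\<lambda>q. - adjoint L q)) p
              = (\<lambda>x. - L x) ` subdifferential (conjugate g) (- adjoint L p)"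
    and "split_bregman_well_defined g f L lam u d b"
    and "split_bregman g f L lam u d b"
  shows "\<exists>dhat bhat.
           weakly_converges d dhat \<and> weakly_converges b bhat \<and>
           dual_solution g f L (lam *\<^sub>R bhat) \<and>
           (\<lambda>k. d k - L (u (Suc k))) \<longlonglongrightarrow> 0 \<and>
           summable (\<lambda>k. (norm (d k - L (u (Suc k))))\<^sup>2) \<and>
           (\<exists>uhat. uhat \<in> L -` {dhat} \<and> primal_solution g f L uhat \<and>
              (inj L \<longrightarrow>
                 (\<exists>\<^sub>\<le>\<^sub>1 ubar. weak_cluster_point u ubar) \<and>
                 (\<forall>ubar. weak_cluster_point u ubar \<longrightarrow> ubar = uhat)))"
proof -
  interpret split_bregman_iteration g f L lam u d b
    by (rule split_bregman_iteration.intro) (fact assms)+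
  obtain x0 where "primal_solution g f L x0" using assms(9) by blast
  then obtain q where "kkt_point g f L x0 q" using kkt_point_exists[OF g f L assms(11)] by blast
  then have kkt0: "kkt_point g f L x0 (lam *\<^sub>R (q /\<^sub>R lam))" using lam by simp
  have cluster: "\<exists>x. L x = dd \<and> kkt_point g f L x (lam *\<^sub>R bb) \<and> dual_solution g f L (lam *\<^sub>R bb)"
    if "G \<le> sequentially" "G \<noteq> bot"
      "\<And>h. ((\<lambda>k. b (Suc k) \<bullet> h) \<longlongrightarrow> bb \<bullet> h) G" "\<And>h. ((\<lambda>k. d (Suc k) \<bullet> h) \<longlongrightarrow> dd \<bullet> h) G"
    for G bb dd
  proof -
    note dual = weak_cluster_dual[OF kkt0 that]
    obtain x where x: "x \<in> subdifferential (conjugate g) (- adjoint L (lam *\<^sub>R bb))" "L x = dd"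
      using dual(1) unfolding assms(12) by auto
    then show ?thesis
      using subdifferential_conjugate_inverse[OF g x(1)]
        subdifferential_conjugate_inverse[OF f dual(2)] dual(3)
      by (auto simp: kkt_point_def)
  qed
  \<comment> \<open>Pairing the sequences gives both weak limits along one and the same filter.\<close>
  define s where "s k = (b (Suc k), d (Suc k))" for k
  obtain B where B: "\<And>k. norm (s k) \<le> B"
    using iterates_bounded[OF kkt0] unfolding s_def by blast
  have split: "((\<lambda>k. b (Suc k) \<bullet> h) \<longlongrightarrow> fst w \<bullet> h) G"
    "((\<lambda>k. d (Suc k) \<bullet> h) \<longlongrightarrow> snd w \<bullet> h) G"
    if "\<And>h. ((\<lambda>k. s k \<bullet> h) \<longlongrightarrow> w \<bullet> h) G" for G w h
    using that[of "(h, 0)"] that[of "(0, h)"] by (simp_all add: s_def inner_prod_def)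
  obtain G w where G: "G \<le> sequentially" "G \<noteq> bot" and w: "\<And>h. ((\<lambda>k. s k \<bullet> h) \<longlongrightarrow> w \<bullet> h) G"
    using bounded_weak_cluster_filter[of sequentially s B] B sequentially_bot by metis
  obtain bhat dhat where w_eq: "w = (bhat, dhat)" by (cases w)
  have wG: "\<And>h. ((\<lambda>k. b (Suc k) \<bullet> h) \<longlongrightarrow> bhat \<bullet> h) G" "\<And>h. ((\<lambda>k. d (Suc k) \<bullet> h) \<longlongrightarrow> dhat \<bullet> h) G"
    using split[OF w] by (simp_all add: w_eq)
  obtain uhat where uhat: "L uhat = dhat" "kkt_point g f L uhat (lam *\<^sub>R bhat)"
    and dual: "dual_solution g f L (lam *\<^sub>R bhat)"
    using cluster[OF G wG] by blast
  have "weakly_converges s w"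
  proof (rule weakly_converges_unique_cluster[OF B])
    fix G' w' assume G': "G' \<le> sequentially" "G' \<noteq> bot"
      and w': "\<And>h. ((\<lambda>k. s k \<bullet> h) \<longlongrightarrow> w' \<bullet> h) G'"
    obtain x' where x': "L x' = snd w'" "kkt_point g f L x' (lam *\<^sub>R fst w')"
      using cluster[OF G' split[OF w']] by blast
    have "fst w' = bhat \<and> L x' = L uhat"
      by (rule weak_cluster_unique[OF x'(2) uhat(2) G' _ _ G])
        (use split[OF w'] wG x' uhat in simp_all)
    then show "w' = w" using x' uhat by (simp add: w_eq prod_eq_iff)
  qed
  then have "(\<lambda>k. s k \<bullet> h) \<longlonglongrightarrow> w \<bullet> h" for h
    unfolding weakly_converges_iff by blast
  note lim = split[OF this]
  have "(\<lambda>k. b k \<bullet> h) \<longlonglongrightarrow> bhat \<bullet> h" "(\<lambda>k. d k \<bullet> h) \<longlonglongrightarrow> dhat \<bullet> h" for h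
    using lim[of h] filterlim_sequentially_Suc[of "\<lambda>k. b k \<bullet> h"]
      filterlim_sequentially_Suc[of "\<lambda>k. d k \<bullet> h"] by (simp_all add: w_eq)
  then have b: "weakly_converges b bhat" and d: "weakly_converges d dhat"
    unfolding weakly_converges_iff by blast+
  have res: "(\<lambda>k. d k - L (u (Suc k))) \<longlonglongrightarrow> 0" by (rule residual_tendsto_zero[OF kkt0])
  have ubar: "ubar = uhat" if inj: "inj L" and cl: "weak_cluster_point u ubar" for ubar
  proof -
    have "L ubar \<bullet> h = dhat \<bullet> h" for h
    proof -
      have adj: "v \<bullet> adjoint L h = L v \<bullet> h" for v
        by (metis adjoint_inner[OF L] inner_commute)
      have dh: "(\<lambda>k. d k \<bullet> h) \<longlonglongrightarrow> dhat \<bullet> h"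
        using d unfolding weakly_converges_iff by blast
      have "(\<lambda>k. d k \<bullet> h - (d k - L (u (Suc k))) \<bullet> h) \<longlonglongrightarrow> dhat \<bullet> h - 0 \<bullet> h"
        by (rule tendsto_diff[OF dh tendsto_inner[OF res tendsto_const]])
      then have "(\<lambda>k. L (u (Suc k)) \<bullet> h) \<longlonglongrightarrow> dhat \<bullet> h" by (simp add: inner_diff_left)
      then have "(\<lambda>k. u (Suc k) \<bullet> adjoint L h) \<longlonglongrightarrow> dhat \<bullet> h"
        by (simp add: adj)
      then have "(\<lambda>k. u k \<bullet> adjoint L h) \<longlonglongrightarrow> dhat \<bullet> h"
        using filterlim_sequentially_Suc[of "\<lambda>k. u k \<bullet> adjoint L h"] by simp
      then have "ubar \<bullet> adjoint L h = dhat \<bullet> h"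
        by (rule weak_cluster_point_inner_limit[OF cl])
      then show ?thesis by (simp add: adj)
    qed
    then have "L ubar = L uhat" using uhat(1) vector_eq_rdot by metis
    then show ?thesis using inj by (simp add: inj_eq)
  qed
  show ?thesis
  proof (intro exI conjI impI allI)
    show "uhat \<in> L -` {dhat}" using uhat(1) by simp
    show "primal_solution g f L uhat" by (rule kkt_point_primal_solution[OF L uhat(2)])
    show "\<exists>\<^sub>\<le>\<^sub>1 ubar. weak_cluster_point u ubar" if "inj L"
      using ubar[OF that] by (intro Uniq_I) metis
  qed (use b d dual res summable_residual[OF kkt0] ubar in auto)
qed

end
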